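(* Let $(E,d)$ be a locally compact separable metric space and $m$ a Radon measure on $E$ with full topological support. Let $k$ be a non-negative Borel measurable function on $E\times E\setminus\{(x,x):x\in E\}$, and put $k_s(x,y)=\tfrac12(k(x,y)+k(y,x))$ and $k_a(x,y)=\tfrac12(k(x,y)-k(y,x))$. Assume $$x\mapsto\int_{y\neq x}\big(1\wedge d(x,y)^2\big)k_s(x,y)\,m(dy)\in L^1_{\mathrm{loc}}(E,m)$$ and $$\sup_{x\in E}\int_{\{y:\,k_s(x,y)\neq 0\}}\frac{k_a(x,y)^2}{k_s(x,y)}\,m(dy)<\infty .$$ Then: (i) For all $u,v\in C_c^{\mathrm{lip}}(E)$ the limit $\eta(u,v)=\lim_{n\to\infty}\eta_n(u,v)$ exists, and $$\eta(u,v)=\frac12\,\mathscr E(u,v)+\iint_{y\neq x}\big(u(x)-u(y)\big)v(y)\,k_a(x,y)\,m(dx)\,m(dy),$$ where the last integral is absolutely convergent. (ii) The form $\eta$ extends from $C_c^{\mathrm{lip}}(E)\times C_c^{\mathrm{lip}}(E)$ to $\mathscr F^0\times\mathscr F^0$ such that $(\eta,\mathscr F^0)$ is a regular lower bounded semi-Dirichlet form on $L^2(E,m)$.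
   Context: $C_c^{\mathrm{lip}}(E)$ denotes the Lipschitz continuous functions on $E$ with compact support; $\langle\cdot,\cdot\rangle_{L^2}$ and $\|\cdot\|_{L^2}$ are the inner product and norm of $L^2(E,m)$. For $n\in\mathbb N$ and $u\in C_c^{\mathrm{lip}}(E)$ set $L_nu(x)=\int_{\{y:\,d(x,y)>1/n\}}(u(y)-u(x))k(x,y)\,m(dy)$, and for $u,v\in C_c^{\mathrm{lip}}(E)$ set $\eta_n(u,v)=-\langle L_nu,v\rangle_{L^2}$. Define $\mathscr E(u,v)=\iint_{y\neq x}(u(x)-u(y))(v(x)-v(y))k_s(x,y)\,m(dx)\,m(dy)$, $\mathscr F^r=\{u\in L^2(E,m)\text{ Borel}:\mathscr E(u,u)<\infty\}$, $\mathscr E_1(u,u)=\mathscr E(u,u)+\|u\|_{L^2}^2$, and let $\mathscr F^0$ be the $\mathscr E_1$-closure of $C_c^{\mathrm{lip}}(E)$ in $\mathscr F^r$. A bilinear form $(\eta,\mathscr F)$ with $\mathscr F\subset L^2(E,m)$ is a lower bounded semi-Dirichlet form if for some $\alpha>0$ and $c>0$: (a) $\eta(u,u)\ge-\alpha\langle u,u\rangle_{L^2}$ for $u\in\mathscr F$; (b) $\eta(u,v)\le c\sqrt{\eta(u,u)+\alpha\langle u,u\rangle_{L^2}}\sqrt{\eta(v,v)+\alpha\langle v,v\rangle_{L^2}}$ for $u,v\in\mathscr F$; (c) $\mathscr F$ is complete with respect to the norm $(\eta(u,u)+\alpha\langle u,u\rangle_{L^2})^{1/2}$; (d) for all $u\in\mathscr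 F$, $u^+\wedge1\in\mathscr F$ and $\eta(u^+\wedge 1,u-u^+\wedge1)\ge0$. It is regular if $\mathscr F\cap C_c(E)$ is dense in $\mathscr F$ for the norm in (c) and dense in $C_c(E)$ for the uniform norm. *)

theory Defs
  imports "HOL-Analysis.Analysis"
begin

definition ks :: "('a \<Rightarrow> 'a \<Rightarrow> real) \<Rightarrow> 'a \<Rightarrow> 'a \<Rightarrow> real" where
  "ks k x y = (k x y + k y x) / 2"

definition ka :: "('a \<Rightarrow> 'a \<Rightarrow> real) \<Rightarrow> 'a \<Rightarrow> 'a \<Rightarrow> real" where
  "ka k x y = (k x y - k y x) / 2"

definition Cc :: "('a::metric_space \<Rightarrow> real) set" where
  "Cc = {u. continuous_on UNIV u \<and> compact (closure {x. u x \<noteq> 0})}"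

definition Cc_lip :: "('a::metric_space \<Rightarrow> real) set" where
  "Cc_lip = {u. (\<exists>C. C-lipschitz_on UNIV u) \<and> compact (closure {x. u x \<noteq> 0})}"

definition L2ip :: "'a measure \<Rightarrow> ('a \<Rightarrow> real) \<Rightarrow> ('a \<Rightarrow> real) \<Rightarrow> real" where
  "L2ip m u v = (\<integral>x. u x * v x \<partial>m)"

definition L2 :: "'a measure \<Rightarrow> ('a \<Rightarrow> real) set" where
  "L2 m = {u. u \<in> borel_measurable m \<and> integrable m (\<lambda>x. (u x)\<^sup>2)}"

definition Ln :: "'a::metric_space measure \<Rightarrow> ('a \<Rightarrow> 'a \<Rightarrow> real) \<Rightarrow> nat \<Rightarrow> ('a \<Rightarrow> real) \<Rightarrow> 'a \<Rightarrow> real" where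
  "Ln m k n u x = (\<integral>y. indicator {y. dist x y > 1 / real n} y * ((u y - u x) * k x y) \<partial>m)"

definition eta_n :: "'a::metric_space measure \<Rightarrow> ('a \<Rightarrow> 'a \<Rightarrow> real) \<Rightarrow> nat \<Rightarrow> ('a \<Rightarrow> real) \<Rightarrow> ('a \<Rightarrow> real) \<Rightarrow> real" where
  "eta_n m k n u v = - L2ip m (Ln m k n u) v"

text \<open>The symmetric form \<E> (real-valued, used where it is finite) and its
  nonnegative diagonal version \<E>(u,u) in [0,\<infinity>].\<close>
definition Eform :: "'a measure \<Rightarrow> ('a \<Rightarrow> 'a \<Rightarrow> real) \<Rightarrow> ('a \<Rightarrow> real) \<Rightarrow> ('a \<Rightarrow> real) \<Rightarrow> real" where
  "Eform m k u v = (\<integral>x. (\<integral>y. indicator {y. y \<noteq> x} y * ((u x - u y) * (v x - v y) * ks k x y) \<partial>m) \<partial>m)"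

definition Eform_nn :: "'a measure \<Rightarrow> ('a \<Rightarrow> 'a \<Rightarrow> real) \<Rightarrow> ('a \<Rightarrow> real) \<Rightarrow> ennreal" where
  "Eform_nn m k u = (\<integral>\<^sup>+x. (\<integral>\<^sup>+y. indicator {y. y \<noteq> x} y * ennreal ((u x - u y)\<^sup>2 * ks k x y) \<partial>m) \<partial>m)"

definition Fr :: "'a measure \<Rightarrow> ('a \<Rightarrow> 'a \<Rightarrow> real) \<Rightarrow> ('a \<Rightarrow> real) set" where
  "Fr m k = {u. u \<in> borel_measurable m \<and> integrable m (\<lambda>x. (u x)\<^sup>2) \<and> Eform_nn m k u < \<infinity>}"

definition E1 :: "'a measure \<Rightarrow> ('a \<Rightarrow> 'a \<Rightarrow> real) \<Rightarrow> ('a \<Rightarrow> real) \<Rightarrow> real" where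
  "E1 m k u = Eform m k u u + L2ip m u u"

definition F0 :: "'a::metric_space measure \<Rightarrow> ('a \<Rightarrow> 'a \<Rightarrow> real) \<Rightarrow> ('a \<Rightarrow> real) set" where
  "F0 m k = {u \<in> Fr m k. \<exists>f. (\<forall>i. f i \<in> Cc_lip) \<and> (\<lambda>i. E1 m k (\<lambda>x. f i x - u x)) \<longlonglongrightarrow> 0}"

definition bilinear_form_L2 :: "'a measure \<Rightarrow> (('a \<Rightarrow> real) \<Rightarrow> ('a \<Rightarrow> real) \<Rightarrow> real) \<Rightarrow> ('a \<Rightarrow> real) set \<Rightarrow> bool" where
  "bilinear_form_L2 m eta F \<longleftrightarrow>
     F \<subseteq> L2 m \<and> (\<lambda>x. 0) \<in> F \<and>
     (\<forall>u\<in>F. \<forall>v\<in>F. \<forall>a b::real. (\<lambda>x. a * u x + b * v x) \<in> F) \<and>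
     (\<forall>u\<in>F. \<forall>u'. u' \<in> borel_measurable m \<and> (AE x in m. u' x = u x) \<longrightarrow> u' \<in> F) \<and>
     (\<forall>u\<in>F. \<forall>u'\<in>F. \<forall>v\<in>F. \<forall>v'\<in>F. (AE x in m. u' x = u x) \<and> (AE x in m. v' x = v x)
        \<longrightarrow> eta u' v' = eta u v) \<and>
     (\<forall>u\<in>F. \<forall>v\<in>F. \<forall>w\<in>F. \<forall>a b::real.
        eta (\<lambda>x. a * u x + b * v x) w = a * eta u w + b * eta v w \<and>
        eta w (\<lambda>x. a * u x + b * v x) = a * eta w u + b * eta w v)"

definition form_norm :: "'a measure \<Rightarrow> (('a \<Rightarrow> real) \<Rightarrow> ('a \<Rightarrow> real) \<Rightarrow> real) \<Rightarrow> real \<Rightarrow> ('a \<Rightarrow> real) \<Rightarrow> real" where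
  "form_norm m eta \<alpha> u = sqrt (eta u u + \<alpha> * L2ip m u u)"

definition lbsdf_with :: "'a measure \<Rightarrow> (('a \<Rightarrow> real) \<Rightarrow> ('a \<Rightarrow> real) \<Rightarrow> real) \<Rightarrow> ('a \<Rightarrow> real) set \<Rightarrow> real \<Rightarrow> real \<Rightarrow> bool" where
  "lbsdf_with m eta F \<alpha> c \<longleftrightarrow>
     bilinear_form_L2 m eta F \<and> \<alpha> > 0 \<and> c > 0 \<and>
     (\<forall>u\<in>F. eta u u \<ge> - \<alpha> * L2ip m u u) \<and>
     (\<forall>u\<in>F. \<forall>v\<in>F. eta u v \<le> c * form_norm m eta \<alpha> u * form_norm m eta \<alpha> v) \<and>
     (\<forall>f. (\<forall>i. f i \<in> F) \<and>
          (\<forall>\<epsilon>>0. \<exists>N. \<forall>i\<ge>N. \<forall>j\<ge>N. form_norm m eta \<alpha> (\<lambda>x. f i x - f j x) < \<epsilon>)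
        \<longrightarrow> (\<exists>g\<in>F. (\<lambda>i. form_norm m eta \<alpha> (\<lambda>x. f i x - g x)) \<longlonglongrightarrow> 0)) \<and>
     (\<forall>u\<in>F. (\<lambda>x. min (max (u x) 0) 1) \<in> F \<and>
        eta (\<lambda>x. min (max (u x) 0) 1) (\<lambda>x. u x - min (max (u x) 0) 1) \<ge> 0)"

definition lower_bounded_semi_Dirichlet_form :: "'a measure \<Rightarrow> (('a \<Rightarrow> real) \<Rightarrow> ('a \<Rightarrow> real) \<Rightarrow> real) \<Rightarrow> ('a \<Rightarrow> real) set \<Rightarrow> bool" where
  "lower_bounded_semi_Dirichlet_form m eta F \<longleftrightarrow> (\<exists>\<alpha> c. lbsdf_with m eta F \<alpha> c)"

definition regular_lbsdf :: "'a::metric_space measure \<Rightarrow> (('a \<Rightarrow> real) \<Rightarrow> ('a \<Rightarrow> real) \<Rightarrow> real) \<Rightarrow> ('a \<Rightarrow> real) set \<Rightarrow> bool" where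
  "regular_lbsdf m eta F \<longleftrightarrow> (\<exists>\<alpha> c. lbsdf_with m eta F \<alpha> c \<and>
     (\<forall>u\<in>F. \<forall>\<epsilon>>0. \<exists>g\<in>F \<inter> Cc. form_norm m eta \<alpha> (\<lambda>x. u x - g x) < \<epsilon>) \<and>
     (\<forall>f\<in>Cc. \<forall>\<epsilon>>0. \<exists>g\<in>F \<inter> Cc. \<forall>x. \<bar>f x - g x\<bar> < \<epsilon>))"

end

theory Submission
  imports Defs
begin

text \<open>On \<open>P = m \<otimes> m\<close>, with the kernel set to \<open>0\<close> on the diagonal, put
  \<open>grad u (x, y) = (u x - u y) \<surd>k\<^sub>s\<close> and \<open>drift v (x, y) = v y k\<^sub>a / \<surd>k\<^sub>s\<close>. Then
  \<open>\<E>(u, v) = \<langle>grad u, grad v\<rangle>\<close> and \<open>\<eta>(u, v) = \<langle>grad u, grad v\<rangle> / 2 + \<langle>grad u, drift v\<rangle>\<close> in \<open>L\<^sup>2(P)\<close>,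
  and the second hypothesis says \<open>\<parallel>drift v\<parallel>\<^sup>2 \<le> C \<parallel>v\<parallel>\<^sup>2\<close>; so Cauchy--Schwarz makes \<open>\<eta>\<close> with \<open>\<alpha> = C + 1\<close>
  equivalent to \<open>\<E>\<^sub>1\<close>. Averaging over \<open>(x, y) \<leftrightarrow> (y, x)\<close> turns \<open>\<eta>(u, v)\<close> into the integral of
  \<open>(u x - u y) (v x k(x, y) - v y k(y, x)) / 2\<close>, and \<open>\<eta>\<^sub>n(u, v)\<close> into the integral of the same function
  over \<open>d(x, y) > 1/n\<close>. This gives the limit by dominated convergence, and the Markov property
  because the integrand is pointwise nonnegative for \<open>w = u\<^sup>+ \<and> 1\<close> and \<open>u - w\<close>. Completeness follows from almost
  everywhere convergence of a subsequence and Fatou's lemma, and truncation preserves \<open>\<F>\<^sup>0\<close>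
  because it is continuous for \<open>\<E>\<^sub>1\<close>, again by dominated convergence.\<close>

subsection \<open>Square-integrable functions\<close>

lemma L2_meas: "u \<in> L2 M \<Longrightarrow> u \<in> borel_measurable M"
  by (simp add: L2_def)

lemma L2_integrable_square: "u \<in> L2 M \<Longrightarrow> integrable M (\<lambda>x. (u x)\<^sup>2)"
  by (simp add: L2_def)

lemma L2ip_self: "L2ip M u u = (\<integral>x. (u x)\<^sup>2 \<partial>M)"
  by (simp add: L2ip_def power2_eq_square)

lemma L2ip_nonneg: "0 \<le> L2ip M u u"
  by (simp add: L2ip_self)

lemma L2ip_commute: "L2ip M u v = L2ip M v u"
  by (simp add: L2ip_def mult.commute)

lemma L2_integrable_mult:
  assumes "u \<in> L2 M" "v \<in> L2 M"
  shows "integrable M (\<lambda>x. u x * v x)"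
proof (rule Bochner_Integration.integrable_bound)
  show "integrable M (\<lambda>x. (u x)\<^sup>2 + (v x)\<^sup>2)"
    using assms by (auto intro: L2_integrable_square)
  show "AE x in M. norm (u x * v x) \<le> norm ((u x)\<^sup>2 + (v x)\<^sup>2)"
  proof (rule AE_I2)
    fix x
    have "2 * (\<bar>u x\<bar> * \<bar>v x\<bar>) \<le> (u x)\<^sup>2 + (v x)\<^sup>2"
      using sum_squares_bound[of "\<bar>u x\<bar>" "\<bar>v x\<bar>"] by simp
    moreover have "0 \<le> \<bar>u x\<bar> * \<bar>v x\<bar>" by simp
    ultimately have "\<bar>u x\<bar> * \<bar>v x\<bar> \<le> (u x)\<^sup>2 + (v x)\<^sup>2" by linarith
    then show "norm (u x * v x) \<le> norm ((u x)\<^sup>2 + (v x)\<^sup>2)"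
      by (simp add: abs_mult)
  qed
qed (use assms in \<open>auto simp: L2_def\<close>)

lemma L2_lincomb:
  assumes "u \<in> L2 M" "v \<in> L2 M"
  shows "(\<lambda>x. a * u x + b * v x) \<in> L2 M"
proof -
  have "integrable M (\<lambda>x. a\<^sup>2 * (u x)\<^sup>2 + 2 * a * b * (u x * v x) + b\<^sup>2 * (v x)\<^sup>2)"
    using assms
    by (intro Bochner_Integration.integrable_add integrable_mult_right L2_integrable_square L2_integrable_mult)
  then have "integrable M (\<lambda>x. (a * u x + b * v x)\<^sup>2)"
    by (simp add: power2_sum power_mult_distrib algebra_simps)
  then show ?thesis
    using assms by (auto simp: L2_def)
qed

lemma L2_diff: "u \<in> L2 M \<Longrightarrow> v \<in> L2 M \<Longrightarrow> (\<lambda>x. u x - v x) \<in> L2 M"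
  using L2_lincomb[of u M v 1 "-1"] by simp

lemma L2ip_lincomb_left:
  assumes "u \<in> L2 M" "v \<in> L2 M" "w \<in> L2 M"
  shows "L2ip M (\<lambda>x. a * u x + b * v x) w = a * L2ip M u w + b * L2ip M v w"
proof -
  have "L2ip M (\<lambda>x. a * u x + b * v x) w = (\<integral>x. a * (u x * w x) + b * (v x * w x) \<partial>M)"
    by (simp add: L2ip_def algebra_simps)
  also have "\<dots> = a * L2ip M u w + b * L2ip M v w"
    using assms by (simp add: L2ip_def L2_integrable_mult)
  finally show ?thesis .
qed

lemma L2ip_lincomb_right:
  assumes "u \<in> L2 M" "v \<in> L2 M" "w \<in> L2 M"
  shows "L2ip M w (\<lambda>x. a * u x + b * v x) = a * L2ip M w u + b * L2ip M w v"
  using L2ip_lincomb_left[OF assms] by (simp add: L2ip_commute)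

lemma L2ip_lincomb_self:
  assumes "u \<in> L2 M" "v \<in> L2 M"
  shows "L2ip M (\<lambda>x. a * u x + b * v x) (\<lambda>x. a * u x + b * v x) =
    a\<^sup>2 * L2ip M u u + 2 * a * b * L2ip M u v + b\<^sup>2 * L2ip M v v"
  using assms
  by (simp add: L2ip_lincomb_left L2ip_lincomb_right L2_lincomb L2ip_commute[of M v u]
      power2_eq_square algebra_simps)

text \<open>Discriminant argument for the quadratic form \<open>q\<close> in the coefficients
  \<open>a\<close> and \<open>b\<close>. On functions the form is only semidefinite, so the
  degenerate case \<open>C = 0\<close> is treated separately.\<close>

lemma L2ip_Cauchy_Schwarz:
  assumes "u \<in> L2 M" "v \<in> L2 M"
  shows "\<bar>L2ip M u v\<bar> \<le> sqrt (L2ip M u u) * sqrt (L2ip M v v)"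
proof -
  define A B C where "A = L2ip M u u" and "B = L2ip M u v" and "C = L2ip M v v"
  have nn: "0 \<le> A" "0 \<le> C"
    by (simp_all add: A_def C_def L2ip_nonneg)
  have q: "0 \<le> a\<^sup>2 * A + 2 * a * b * B + b\<^sup>2 * C" for a b
    using L2ip_lincomb_self[OF assms, of a b] L2ip_nonneg[of M "\<lambda>x. a * u x + b * v x"]
    by (simp add: A_def B_def C_def)
  have "B\<^sup>2 \<le> A * C"
  proof (cases "C = 0")
    case True
    show ?thesis
    proof (rule ccontr)
      assume "\<not> ?thesis"
      then have B: "B \<noteq> 0" using True by auto
      \<comment> \<open>For \<open>C = 0\<close> and \<open>a = 1\<close> the form is affine in
        \<open>b\<close>; this \<open>b\<close> gives it the value -1.\<close>
      have "0 \<le> A + 2 * (- (A + 1) / (2 * B)) * B"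
        using q[of 1 "- (A + 1) / (2 * B)"] True by simp
      also have "\<dots> = -1" using B by (simp add: field_simps)
      finally show False by simp
    qed
  next
    case False
    then have C: "0 < C" using nn by simp
    \<comment> \<open>For \<open>a = C\<close> the form is smallest at
      \<open>b = -B\<close>.\<close>
    have "0 \<le> C * (A * C - B\<^sup>2)"
      using q[of C "-B"] by (simp add: power2_eq_square algebra_simps)
    then show ?thesis
      using C by (simp add: zero_le_mult_iff)
  qed
  then have "sqrt (B\<^sup>2) \<le> sqrt (A * C)" by (rule real_sqrt_le_mono)
  then show ?thesis
    by (simp add: A_def B_def C_def real_sqrt_mult)
qed

text \<open>The parallelogram law with the square of the sum dropped. It replaces the triangle
  inequality for squared norms.\<close>

lemma L2ip_diff_self_le:
  assumes "u \<in> L2 M" "v \<in> L2 M"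
  shows "L2ip M (\<lambda>x. u x - v x) (\<lambda>x. u x - v x) \<le> 2 * L2ip M u u + 2 * L2ip M v v"
proof -
  have "0 \<le> L2ip M u u + 2 * L2ip M u v + L2ip M v v"
    using L2ip_lincomb_self[OF assms, of 1 1] L2ip_nonneg[of M "\<lambda>x. u x + v x"] by simp
  then show ?thesis
    using L2ip_lincomb_self[OF assms, of 1 "-1"] by simp
qed

lemma L2_AE_cong:
  assumes "u \<in> L2 M" "u' \<in> borel_measurable M" "AE x in M. u' x = u x"
  shows "u' \<in> L2 M"
proof -
  have "integrable M (\<lambda>x. (u' x)\<^sup>2) \<longleftrightarrow> integrable M (\<lambda>x. (u x)\<^sup>2)"
    using assms L2_meas[OF assms(1)] by (intro integrable_cong_AE) auto
  then show ?thesis using assms by (simp add: L2_def)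
qed

lemma L2ip_AE_cong:
  assumes "u \<in> L2 M" "u' \<in> L2 M" "v \<in> L2 M" "v' \<in> L2 M"
    and "AE x in M. u' x = u x" "AE x in M. v' x = v x"
  shows "L2ip M u' v' = L2ip M u v"
  unfolding L2ip_def
proof (rule integral_cong_AE)
  show "AE x in M. u' x * v' x = u x * v x"
    using assms(5,6) by eventually_elim simp
qed (use assms(1-4)[THEN L2_meas] in measurable)

lemma nn_integral_square_L2: "u \<in> L2 M \<Longrightarrow> (\<integral>\<^sup>+x. ennreal ((u x)\<^sup>2) \<partial>M) = ennreal (L2ip M u u)"
  by (simp add: L2ip_self nn_integral_eq_integral L2_integrable_square)

lemma L2_nn_integralI:
  assumes "u \<in> borel_measurable M" "(\<integral>\<^sup>+x. ennreal ((u x)\<^sup>2) \<partial>M) < \<infinity>"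
  shows "u \<in> L2 M"
  using assms unfolding L2_def by (auto intro!: integrableI_nonneg)

section \<open>Domination and limits in \<open>L2 M\<close>\<close>

lemma L2_dominated:
  assumes "u \<in> L2 M" "v \<in> borel_measurable M" "\<And>x. \<bar>v x\<bar> \<le> \<bar>u x\<bar>"
  shows "v \<in> L2 M"
proof -
  have "integrable M (\<lambda>x. (v x)\<^sup>2)"
  proof (rule Bochner_Integration.integrable_bound[OF L2_integrable_square[OF assms(1)]])
    show "AE x in M. norm ((v x)\<^sup>2) \<le> norm ((u x)\<^sup>2)"
      using assms(3) by (auto simp: abs_le_square_iff)
  qed (use assms(2) in measurable)
  then show ?thesis using assms(2) by (simp add: L2_def)
qed

text \<open>Fatou's lemma for the squares. It yields membership and bound at once, for limits not
  yet known to be square-integrable; the limit inferior ignores the indices below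
  \<open>N\<close>.\<close>

lemma L2_Fatou:
  assumes h: "\<And>n. h n \<in> L2 M" and g [measurable]: "g \<in> borel_measurable M"
    and lim: "AE x in M. (\<lambda>n. h n x) \<longlonglongrightarrow> g x"
    and bd: "\<And>n. n \<ge> N \<Longrightarrow> L2ip M (h n) (h n) \<le> b"
  shows "g \<in> L2 M" and "L2ip M g g \<le> b"
proof -
  note [measurable] = L2_meas[OF h]
  have b: "0 \<le> b" using bd[of N] L2ip_nonneg[of M "h N"] by simp
  have "(\<integral>\<^sup>+x. ennreal ((g x)\<^sup>2) \<partial>M) = (\<integral>\<^sup>+x. liminf (\<lambda>n. ennreal ((h n x)\<^sup>2)) \<partial>M)"
  proof (rule nn_integral_cong_AE, use lim in eventually_elim)
    fix x assume "(\<lambda>n. h n x) \<longlonglongrightarrow> g x"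
    then have "(\<lambda>n. ennreal ((h n x)\<^sup>2)) \<longlonglongrightarrow> ennreal ((g x)\<^sup>2)"
      by (intro tendsto_ennrealI tendsto_power)
    then show "ennreal ((g x)\<^sup>2) = liminf (\<lambda>n. ennreal ((h n x)\<^sup>2))"
      by (intro lim_imp_Liminf[symmetric] trivial_limit_sequentially)
  qed
  also have "\<dots> \<le> liminf (\<lambda>n. \<integral>\<^sup>+x. ennreal ((h n x)\<^sup>2) \<partial>M)"
    by (rule nn_integral_liminf) measurable
  also have "\<dots> \<le> liminf (\<lambda>n. ennreal b)"
  proof (rule Liminf_mono)
    show "\<forall>\<^sub>F n in sequentially. (\<integral>\<^sup>+x. ennreal ((h n x)\<^sup>2) \<partial>M) \<le> ennreal b"
      using bd by (auto simp: eventually_sequentially nn_integral_square_L2[OF h] intro!: exI[of _ N] ennreal_leI)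
  qed
  finally have le: "(\<integral>\<^sup>+x. ennreal ((g x)\<^sup>2) \<partial>M) \<le> ennreal b"
    by (simp add: Liminf_const)
  show L: "g \<in> L2 M"
    using le by (intro L2_nn_integralI) (auto intro: le_less_trans)
  show "L2ip M g g \<le> b"
    using le b by (simp add: nn_integral_square_L2[OF L])
qed

text \<open>With \<open>r\<close> so fast that the squared distances are at most \<open>8\<^sup>-\<^sup>n\<close>, the weighted sum
  \<open>\<Sum>4\<^sup>n \<bar>f (r (n+1)) - f (r n)\<bar>\<^sup>2\<close> is integrable, so the increments are almost everywhere
  dominated by a geometric sequence.\<close>
lemma L2_Cauchy_AE_convergent_subseq:
  assumes f: "\<And>i. f i \<in> L2 M"
    and Cauchy: "\<And>e. e > 0 \<Longrightarrow>
      \<exists>N. \<forall>i\<ge>N. \<forall>j\<ge>N. L2ip M (\<lambda>x. f i x - f j x) (\<lambda>x. f i x - f j x) < e"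
  obtains r g where "strict_mono (r :: nat \<Rightarrow> nat)" "g \<in> borel_measurable M"
    "AE x in M. (\<lambda>n. f (r n) x) \<longlonglongrightarrow> g x"
proof -
  note [measurable] = L2_meas[OF f]
  have "\<exists>N. \<forall>i\<ge>N. \<forall>j\<ge>N. L2ip M (\<lambda>x. f i x - f j x) (\<lambda>x. f i x - f j x) < (1/8) ^ n" for n
    by (rule Cauchy) simp
  then obtain N where N: "\<And>n i j. i \<ge> N n \<Longrightarrow> j \<ge> N n \<Longrightarrow>
      L2ip M (\<lambda>x. f i x - f j x) (\<lambda>x. f i x - f j x) < (1/8) ^ n"
    by metis
  \<comment> \<open>The sum is strictly increasing in \<open>n\<close> and exceeds each
    \<open>N n\<close>, although \<open>N\<close> need not be monotone.\<close>
  define r where "r n = (\<Sum>i\<le>n. Suc (N i))" for n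
  have r: "strict_mono r"
    by (rule strict_mono_Suc_iff[THEN iffD2]) (simp add: r_def)
  have rN: "N n \<le> r n" for n
  proof -
    have "Suc (N n) \<le> r n"
      unfolding r_def by (rule member_le_sum) auto
    then show ?thesis by simp
  qed
  have rN': "N n \<le> r (Suc n)" for n
    using rN[of n] strict_monoD[OF r, of n "Suc n"] by simp
  define D where "D n x = f (r (Suc n)) x - f (r n) x" for n x
  have D: "D n \<in> L2 M" for n
    unfolding D_def by (intro L2_diff f)
  note [measurable] = L2_meas[OF D]
  have D_le: "L2ip M (D n) (D n) \<le> (1/8) ^ n" for n
    unfolding D_def by (rule less_imp_le) (rule N[OF rN' rN])
  have "(\<integral>\<^sup>+x. (\<Sum>n. ennreal (4 ^ n * (D n x)\<^sup>2)) \<partial>M) = (\<Sum>n. \<integral>\<^sup>+x. ennreal (4 ^ n * (D n x)\<^sup>2) \<partial>M)"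
    by (rule nn_integral_suminf) measurable
  also have "\<dots> \<le> (\<Sum>n. ennreal ((1/2) ^ n))"
  proof (rule suminf_le)
    fix n
    have "(\<integral>\<^sup>+x. ennreal (4 ^ n * (D n x)\<^sup>2) \<partial>M) = ennreal (4 ^ n * L2ip M (D n) (D n))"
      by (simp add: ennreal_mult nn_integral_cmult nn_integral_square_L2[OF D] L2ip_nonneg)
    also have "\<dots> \<le> ennreal (4 ^ n * (1/8) ^ n)"
      by (intro ennreal_leI mult_left_mono D_le) simp
    also have "4 ^ n * (1/8) ^ n = ((1/2) ^ n :: real)"
      by (simp flip: power_mult_distrib)
    finally show "(\<integral>\<^sup>+x. ennreal (4 ^ n * (D n x)\<^sup>2) \<partial>M) \<le> ennreal ((1/2) ^ n)" .
  qed auto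
  also have "\<dots> = ennreal (\<Sum>n. (1/2) ^ n)"
    by (rule suminf_ennreal2) (auto simp: summable_geometric)
  finally have "(\<integral>\<^sup>+x. (\<Sum>n. ennreal (4 ^ n * (D n x)\<^sup>2)) \<partial>M) \<noteq> \<infinity>"
    by (auto simp: top_unique)
  then have "AE x in M. (\<Sum>n. ennreal (4 ^ n * (D n x)\<^sup>2)) \<noteq> \<infinity>"
    by (intro nn_integral_PInf_AE) measurable
  then have conv: "AE x in M. convergent (\<lambda>n. f (r n) x)"
  proof eventually_elim
    fix x assume "(\<Sum>n. ennreal (4 ^ n * (D n x)\<^sup>2)) \<noteq> \<infinity>"
    then have "summable (\<lambda>n. 4 ^ n * (D n x)\<^sup>2)"
      by (intro summable_suminf_not_top) auto
    then have "Bseq (\<lambda>n. 4 ^ n * (D n x)\<^sup>2)"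
      using summable_LIMSEQ_zero convergentI convergent_imp_Bseq by blast
    then obtain B where B: "\<And>n. 4 ^ n * (D n x)\<^sup>2 \<le> B"
      by (auto simp: Bseq_def)
    have "\<bar>D n x\<bar> \<le> sqrt B * (1/2) ^ n" for n
    proof -
      have "sqrt (4 ^ n * (D n x)\<^sup>2) \<le> sqrt B"
        using B by (rule real_sqrt_le_mono)
      moreover have "sqrt (4 ^ n) = (2::real) ^ n"
        by (simp add: real_sqrt_power)
      ultimately have "2 ^ n * \<bar>D n x\<bar> \<le> sqrt B"
        by (simp add: real_sqrt_mult)
      then show ?thesis by (simp add: field_simps)
    qed
    then have "summable (\<lambda>n. \<bar>D n x\<bar>)"
      by (intro summable_rabs_comparison_test[where g="\<lambda>n. sqrt B * (1/2) ^ n"] exI)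
        (auto intro!: summable_mult summable_geometric)
    then have "summable (\<lambda>n. D n x)"
      by (rule summable_rabs_cancel)
    then have "convergent (\<lambda>n. (\<Sum>i<n. D i x) + f (r 0) x)"
      by (intro convergent_add convergent_const) (simp add: summable_iff_convergent)
    then show "convergent (\<lambda>n. f (r n) x)"
      by (simp add: D_def sum_lessThan_telescope[where f="\<lambda>n. f (r n) x"])
  qed
  show ?thesis
  proof (rule that[OF r, of "\<lambda>x. lim (\<lambda>n. f (r n) x)"])
    show "AE x in M. (\<lambda>n. f (r n) x) \<longlonglongrightarrow> lim (\<lambda>n. f (r n) x)"
      using conv by eventually_elim (simp add: convergent_LIMSEQ_iff)
  qed measurable
qed

text \<open>Dominated convergence with a moving majorant: \<open>b i\<close> is bounded only by
  \<open>a i\<close>, which itself varies, but the part of the error that \<open>a i - a'\<close>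
  does not control has a fixed integrable bound. It is applied to truncated functions and to their
  gradients.\<close>

lemma L2_contraction_tendsto:
  assumes a: "\<And>i. a i \<in> L2 M" "a' \<in> L2 M"
    and b: "\<And>i. b i \<in> borel_measurable M" "b' \<in> borel_measurable M"
    and le: "\<And>i x. \<bar>b i x\<bar> \<le> \<bar>a i x\<bar>" "\<And>x. \<bar>b' x\<bar> \<le> \<bar>a' x\<bar>"
    and lim: "(\<lambda>i. L2ip M (\<lambda>x. a i x - a' x) (\<lambda>x. a i x - a' x)) \<longlonglongrightarrow> 0"
    and AE_lim: "AE x in M. (\<lambda>i. b i x) \<longlonglongrightarrow> b' x"
  shows "(\<lambda>i. L2ip M (\<lambda>x. b i x - b' x) (\<lambda>x. b i x - b' x)) \<longlonglongrightarrow> 0"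
proof -
  note [measurable] = L2_meas[OF a(1)] L2_meas[OF a(2)] b
  \<comment> \<open>The 4 comes from using
    \<open>(s - t)\<^sup>2 \<le> 2 * s\<^sup>2 + 2 * t\<^sup>2\<close> twice: the squared error is
    at most twice the sum of the squares of \<open>a i\<close> and \<open>a'\<close>, and the square
    of \<open>a i\<close> is at most twice that of \<open>a i - a'\<close> plus twice that of
    \<open>a'\<close>. What remains is 6 times the square of \<open>a'\<close>.\<close>
  define c where "c i x = max ((b i x - b' x)\<^sup>2 - 4 * (a i x - a' x)\<^sup>2) 0" for i x
  have c_meas [measurable]: "c i \<in> borel_measurable M" for i
    unfolding c_def by measurable
  have c_le: "c i x \<le> 6 * (a' x)\<^sup>2" for i x
  proof -
    have sq: "(s - t)\<^sup>2 \<le> 2 * s\<^sup>2 + 2 * t\<^sup>2" for s t :: real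
      using zero_le_power2[of "s + t"] by (simp add: power2_diff power2_sum)
    have "(b i x)\<^sup>2 \<le> (a i x)\<^sup>2" "(b' x)\<^sup>2 \<le> (a' x)\<^sup>2"
      using le by (simp_all add: abs_le_square_iff)
    then show ?thesis
      using sq[of "b i x" "b' x"] sq[of "a i x - a' x" "- a' x"] by (simp add: c_def)
  qed
  have "(\<lambda>i. \<integral>x. c i x \<partial>M) \<longlonglongrightarrow> (\<integral>x. 0 \<partial>M)"
  proof (rule integral_dominated_convergence)
    show "integrable M (\<lambda>x. 6 * (a' x)\<^sup>2)"
      using a(2) by (simp add: L2_def)
    show "AE x in M. norm (c i x) \<le> 6 * (a' x)\<^sup>2" for i
      using c_le by (auto simp: c_def)
    show "AE x in M. (\<lambda>i. c i x) \<longlonglongrightarrow> 0"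
      using AE_lim
    proof eventually_elim
      fix x assume "(\<lambda>i. b i x) \<longlonglongrightarrow> b' x"
      then have "(\<lambda>i. (b i x - b' x)\<^sup>2) \<longlonglongrightarrow> (b' x - b' x)\<^sup>2"
        by (intro tendsto_intros)
      then have "(\<lambda>i. (b i x - b' x)\<^sup>2) \<longlonglongrightarrow> 0" by simp
      then show "(\<lambda>i. c i x) \<longlonglongrightarrow> 0"
        by (rule tendsto_sandwich[OF _ _ tendsto_const, rotated 2]) (auto simp: c_def)
    qed
  qed measurable
  then have cl: "(\<lambda>i. \<integral>x. c i x \<partial>M) \<longlonglongrightarrow> 0" by simp
  have c_int: "integrable M (c i)" for i
  proof (rule Bochner_Integration.integrable_bound)
    show "integrable M (\<lambda>x. 6 * (a' x)\<^sup>2)"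
      using a(2) by (simp add: L2_def)
    show "AE x in M. norm (c i x) \<le> norm (6 * (a' x)\<^sup>2)"
      using c_le by (auto simp: c_def)
  qed measurable
  have bL2: "b i \<in> L2 M" "b' \<in> L2 M" for i
    by (rule L2_dominated[OF a(1)[of i]] L2_dominated[OF a(2)]; use b le in simp)+
  have ub: "L2ip M (\<lambda>x. b i x - b' x) (\<lambda>x. b i x - b' x) \<le>
      (\<integral>x. c i x \<partial>M) + 4 * L2ip M (\<lambda>x. a i x - a' x) (\<lambda>x. a i x - a' x)" for i
  proof -
    have ia: "integrable M (\<lambda>x. (a i x - a' x)\<^sup>2)"
      by (intro L2_integrable_square L2_diff a)
    have "(\<integral>x. (b i x - b' x)\<^sup>2 \<partial>M) \<le> (\<integral>x. c i x + 4 * (a i x - a' x)\<^sup>2 \<partial>M)"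
    proof (rule integral_mono)
      show "(b i x - b' x)\<^sup>2 \<le> c i x + 4 * (a i x - a' x)\<^sup>2" for x
        by (simp add: c_def)
    qed (intro ia c_int bL2 L2_integrable_square L2_diff Bochner_Integration.integrable_add
        integrable_mult_right)+
    then show ?thesis
      using ia c_int by (simp add: L2ip_self)
  qed
  show ?thesis
  proof (rule tendsto_sandwich[OF _ _ tendsto_const])
    show "(\<lambda>i. (\<integral>x. c i x \<partial>M) + 4 * L2ip M (\<lambda>x. a i x - a' x) (\<lambda>x. a i x - a' x)) \<longlonglongrightarrow> 0"
      using tendsto_add[OF cl tendsto_mult[OF tendsto_const[of 4] lim]] by simp
  qed (intro always_eventually allI ub L2ip_nonneg)+
qed

lemma L2_tendsto_AE_subseq:
  assumes "\<And>i. f i \<in> L2 M" "g \<in> L2 M"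
    and lim: "(\<lambda>i. L2ip M (\<lambda>x. f i x - g x) (\<lambda>x. f i x - g x)) \<longlonglongrightarrow> 0"
  obtains r where "strict_mono (r :: nat \<Rightarrow> nat)" "AE x in M. (\<lambda>n. f (r n) x) \<longlonglongrightarrow> g x"
proof -
  have "\<exists>r :: nat \<Rightarrow> nat. strict_mono r \<and> (AE x in M. (\<lambda>n. (f (r n) x - g x)\<^sup>2) \<longlonglongrightarrow> 0)"
  proof (rule tendsto_L1_AE_subseq)
    show "integrable M (\<lambda>x. (f n x - g x)\<^sup>2)" for n
      by (intro L2_integrable_square L2_diff assms)
  qed (use lim in \<open>simp add: L2ip_self\<close>)
  then obtain r :: "nat \<Rightarrow> nat" where r: "strict_mono r"
    "AE x in M. (\<lambda>n. (f (r n) x - g x)\<^sup>2) \<longlonglongrightarrow> 0" by blast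
  have "AE x in M. (\<lambda>n. f (r n) x) \<longlonglongrightarrow> g x"
    using r(2)
  proof eventually_elim
    fix x assume "(\<lambda>n. (f (r n) x - g x)\<^sup>2) \<longlonglongrightarrow> 0"
    from tendsto_real_sqrt[OF this] have "(\<lambda>n. f (r n) x - g x) \<longlonglongrightarrow> 0"
      by (simp add: tendsto_rabs_zero_iff)
    then show "(\<lambda>n. f (r n) x) \<longlonglongrightarrow> g x"
      by (rule LIM_zero_cancel)
  qed
  with r(1) show ?thesis by (rule that)
qed

subsection \<open>The form of a jump kernel\<close>

text \<open>Hypotheses for a kernel that is nonnegative on the diagonal too. No indicators are
  needed, since \<open>dist x y\<close> and \<open>ka k x y\<close> vanish for \<open>x = y\<close>,
  and division by 0 gives 0 in \<open>ka_bound\<close> where \<open>ks\<close> vanishes. Joint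
  measurability of the distance is assumed because the type is not second countable; it is derived
  from separability below.\<close>

locale jump_form = base: sigma_finite_measure m for m :: "'a::metric_space measure" +
  fixes k :: "'a \<Rightarrow> 'a \<Rightarrow> real" and C :: real
  assumes sets_m: "sets m = sets borel"
    and emeasure_compact: "compact K \<Longrightarrow> emeasure m K < \<infinity>"
    and k_nonneg: "0 \<le> k x y"
    and k_meas: "(\<lambda>p. k (fst p) (snd p)) \<in> borel_measurable (m \<Otimes>\<^sub>M m)"
    and dist_meas [measurable]: "(\<lambda>p. dist (fst p) (snd p)) \<in> borel_measurable (m \<Otimes>\<^sub>M m)"
    and L1loc: "compact K \<Longrightarrow>
       (\<integral>\<^sup>+x\<in>K. (\<integral>\<^sup>+y. ennreal (min 1 ((dist x y)\<^sup>2) * ks k x y) \<partial>m) \<partial>m) < \<infinity>"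
    and C_nonneg: "0 \<le> C"
    and ka_bound: "(\<integral>\<^sup>+y. ennreal ((ka k x y)\<^sup>2 / ks k x y) \<partial>m) \<le> ennreal C"
begin

sublocale pair_sigma_finite m m ..

abbreviation "P \<equiv> m \<Otimes>\<^sub>M m"

lemma kernel_meas [measurable (raw)]:
  assumes "f \<in> measurable M m" "g \<in> measurable M m"
  shows "(\<lambda>x. k (f x) (g x)) \<in> borel_measurable M"
  using measurable_compose[OF measurable_Pair[OF assms] k_meas] by simp

lemma ks_meas [measurable (raw)]:
  assumes [measurable]: "f \<in> measurable M m" "g \<in> measurable M m"
  shows "(\<lambda>x. ks k (f x) (g x)) \<in> borel_measurable M"
  unfolding ks_def by measurable

lemma ka_meas [measurable (raw)]:
  assumes [measurable]: "f \<in> measurable M m" "g \<in> measurable M m"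
  shows "(\<lambda>x. ka k (f x) (g x)) \<in> borel_measurable M"
  unfolding ka_def by measurable

lemma ks_nonneg: "0 \<le> ks k x y"
  using k_nonneg[of x y] k_nonneg[of y x] by (simp add: ks_def)

lemma ks_commute: "ks k x y = ks k y x"
  by (simp add: ks_def)

lemma ka_commute: "ka k x y = - ka k y x"
  by (simp add: ka_def field_simps)

lemma k_eq: "k x y = ks k x y + ka k x y"
  by (simp add: ks_def ka_def field_simps)

lemma ka_eq_0: "ks k x y = 0 \<Longrightarrow> ka k x y = 0"
  using k_nonneg[of x y] k_nonneg[of y x] by (simp add: ks_def ka_def)

lemma k_le: "k x y \<le> 2 * ks k x y"
  using k_nonneg[of y x] by (simp add: ks_def)

section \<open>Gradient and drift as elements of \<open>L2 P\<close>\<close>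

definition grad :: "('a \<Rightarrow> real) \<Rightarrow> 'a \<times> 'a \<Rightarrow> real" where
  "grad u p = (u (fst p) - u (snd p)) * sqrt (ks k (fst p) (snd p))"

definition drift :: "('a \<Rightarrow> real) \<Rightarrow> 'a \<times> 'a \<Rightarrow> real" where
  "drift v p = v (snd p) * (ka k (fst p) (snd p) / sqrt (ks k (fst p) (snd p)))"

lemma grad_mult_grad:
  "grad u p * grad v p = (u (fst p) - u (snd p)) * (v (fst p) - v (snd p)) * ks k (fst p) (snd p)"
proof -
  have "grad u p * grad v p = (u (fst p) - u (snd p)) * (v (fst p) - v (snd p)) *
      (sqrt (ks k (fst p) (snd p)) * sqrt (ks k (fst p) (snd p)))"
    unfolding grad_def by (simp only: mult_ac)
  then show ?thesis
    by (simp add: ks_nonneg)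
qed

lemma grad_square: "(grad u p)\<^sup>2 = (u (fst p) - u (snd p))\<^sup>2 * ks k (fst p) (snd p)"
  using grad_mult_grad[of u p u] by (simp add: power2_eq_square)

text \<open>Where \<open>ks\<close> is nonzero the square roots cancel. Where it is 0, the left side
  is 0, and so is the right side, because nonnegativity of \<open>k\<close> forces \<open>ka\<close>
  to vanish as well.\<close>

lemma grad_mult_drift:
  "grad u p * drift v p = (u (fst p) - u (snd p)) * v (snd p) * ka k (fst p) (snd p)"
  using ka_eq_0[of "fst p" "snd p"] by (cases "ks k (fst p) (snd p) = 0") (simp_all add: grad_def drift_def)

lemma grad_lincomb: "grad (\<lambda>x. a * u x + b * v x) = (\<lambda>p. a * grad u p + b * grad v p)"
  by (simp add: grad_def fun_eq_iff algebra_simps)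

lemma grad_diff: "grad (\<lambda>x. u x - v x) = (\<lambda>p. grad u p - grad v p)"
  by (simp add: grad_def fun_eq_iff algebra_simps)

lemma drift_lincomb: "drift (\<lambda>x. a * u x + b * v x) = (\<lambda>p. a * drift u p + b * drift v p)"
  by (simp add: drift_def fun_eq_iff add_divide_distrib algebra_simps)

lemma grad_meas [measurable (raw)]:
  assumes [measurable]: "u \<in> borel_measurable m"
  shows "grad u \<in> borel_measurable P"
  unfolding grad_def by measurable

lemma drift_meas [measurable (raw)]:
  assumes [measurable]: "u \<in> borel_measurable m"
  shows "drift u \<in> borel_measurable P"
  unfolding drift_def by measurable

text \<open>Tonelli's theorem; the off-diagonal indicator disappears because \<open>grad u\<close>
  is 0 on the diagonal.\<close>

lemma Eform_nn_eq_grad: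
  assumes [measurable]: "u \<in> borel_measurable m"
  shows "Eform_nn m k u = (\<integral>\<^sup>+p. ennreal ((grad u p)\<^sup>2) \<partial>P)"
proof -
  have "Eform_nn m k u = (\<integral>\<^sup>+x. \<integral>\<^sup>+y. ennreal ((grad u (x, y))\<^sup>2) \<partial>m \<partial>m)"
    unfolding Eform_nn_def grad_square
    by (intro nn_integral_cong) (auto split: split_indicator)
  also have "\<dots> = (\<integral>\<^sup>+p. ennreal ((grad u p)\<^sup>2) \<partial>P)"
    by (rule base.nn_integral_fst) measurable
  finally show ?thesis .
qed

text \<open>Since \<open>grad\<close> is linear, the vector space and limit properties of
  \<open>Fr\<close> are inherited from \<open>L2 m\<close> and \<open>L2 P\<close> through this
  description.\<close>

lemma Fr_iff: "u \<in> Fr m k \<longleftrightarrow> u \<in> L2 m \<and> grad u \<in> L2 P"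
proof
  assume u: "u \<in> Fr m k"
  then have "u \<in> L2 m" by (simp add: Fr_def L2_def)
  moreover have "grad u \<in> L2 P"
    using u by (intro L2_nn_integralI) (auto simp: Fr_def Eform_nn_eq_grad)
  ultimately show "u \<in> L2 m \<and> grad u \<in> L2 P" by simp
next
  assume u: "u \<in> L2 m \<and> grad u \<in> L2 P"
  then show "u \<in> Fr m k"
    by (auto simp: Fr_def L2_def Eform_nn_eq_grad[OF L2_meas] nn_integral_eq_integral less_top)
qed

lemma Eform_eq_grad:
  assumes "u \<in> Fr m k" "v \<in> Fr m k"
  shows "Eform m k u v = L2ip P (grad u) (grad v)"
proof -
  have "Eform m k u v = (\<integral>x. \<integral>y. grad u (x, y) * grad v (x, y) \<partial>m \<partial>m)"
    unfolding Eform_def grad_mult_grad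
    by (intro Bochner_Integration.integral_cong refl) (auto split: split_indicator)
  also have "\<dots> = L2ip P (grad u) (grad v)"
    unfolding L2ip_def using assms by (intro integral_fst' L2_integrable_mult) (auto simp: Fr_iff)
  finally show ?thesis .
qed

lemma E1_eq:
  assumes "u \<in> Fr m k"
  shows "E1 m k u = L2ip P (grad u) (grad u) + L2ip m u u"
  using assms by (simp add: E1_def Eform_eq_grad)

lemma E1_nonneg: "u \<in> Fr m k \<Longrightarrow> 0 \<le> E1 m k u"
  by (simp add: E1_eq L2ip_nonneg)

lemma Fr_lincomb:
  assumes "u \<in> Fr m k" "v \<in> Fr m k"
  shows "(\<lambda>x. a * u x + b * v x) \<in> Fr m k"
  using assms by (simp add: Fr_iff grad_lincomb L2_lincomb)

lemma Fr_diff: "u \<in> Fr m k \<Longrightarrow> v \<in> Fr m k \<Longrightarrow> (\<lambda>x. u x - v x) \<in> Fr m k"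
  using Fr_lincomb[of u v 1 "-1"] by simp

lemma E1_diff_le:
  assumes "u \<in> Fr m k" "v \<in> Fr m k"
  shows "E1 m k (\<lambda>x. u x - v x) \<le> 2 * E1 m k u + 2 * E1 m k v"
proof -
  have "L2ip P (grad (\<lambda>x. u x - v x)) (grad (\<lambda>x. u x - v x)) \<le>
      2 * L2ip P (grad u) (grad u) + 2 * L2ip P (grad v) (grad v)"
    unfolding grad_diff using assms by (intro L2ip_diff_self_le) (auto simp: Fr_iff)
  moreover have "L2ip m (\<lambda>x. u x - v x) (\<lambda>x. u x - v x) \<le> 2 * L2ip m u u + 2 * L2ip m v v"
    using assms by (intro L2ip_diff_self_le) (auto simp: Fr_iff)
  ultimately show ?thesis
    using assms by (simp add: E1_eq Fr_diff)
qed

lemma E1_mult: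
  assumes "u \<in> Fr m k"
  shows "E1 m k (\<lambda>x. a * u x) = a\<^sup>2 * E1 m k u"
proof -
  have "(\<lambda>x. a * u x) \<in> Fr m k"
    using Fr_lincomb[OF assms assms, of a 0] by simp
  moreover have "grad (\<lambda>x. a * u x) = (\<lambda>p. a * grad u p)"
    using grad_lincomb[of a u 0 u] by simp
  ultimately show ?thesis
    using assms by (simp add: E1_eq L2ip_self power_mult_distrib algebra_simps)
qed

lemma E1_minus_commute: "E1 m k (\<lambda>x. u x - v x) = E1 m k (\<lambda>x. v x - u x)"
  by (simp add: E1_def Eform_def L2ip_def power2_commute algebra_simps)

text \<open>A null set \<open>N\<close> of \<open>m\<close> produces only the two null strips over
  \<open>N\<close> in \<open>P\<close>, by sigma-finiteness. This carries almost everywhere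
  statements about functions over to their gradients and drifts.\<close>

lemma AE_pair_both:
  assumes "AE x in m. Q x"
  shows "AE p in P. Q (fst p) \<and> Q (snd p)"
proof -
  obtain N where N: "N \<in> null_sets m" "{x \<in> space m. \<not> Q x} \<subseteq> N"
    using assms unfolding eventually_ae_filter by auto
  have "N \<times> space m \<union> space m \<times> N \<in> null_sets P"
    using N(1) by (intro null_sets.Un base.times_in_null_sets1 base.times_in_null_sets2) auto
  moreover have "{p \<in> space P. \<not> (Q (fst p) \<and> Q (snd p))} \<subseteq> N \<times> space m \<union> space m \<times> N"
    using N(2) by (auto simp: space_pair_measure)
  ultimately show ?thesis by (rule AE_I')
qed

lemma grad_AE_cong:
  assumes "AE x in m. u' x = u x"
  shows "AE p in P. grad u' p = grad u p"
  using AE_pair_both[OF assms] by eventually_elim (simp add: grad_def)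

lemma drift_AE_cong:
  assumes "AE x in m. u' x = u x"
  shows "AE p in P. drift u' p = drift u p"
  using AE_pair_both[OF assms] by eventually_elim (simp add: drift_def)

lemma Fr_AE_cong:
  assumes "u \<in> Fr m k" "u' \<in> borel_measurable m" "AE x in m. u' x = u x"
  shows "u' \<in> Fr m k"
  using assms L2_AE_cong[OF _ assms(2,3)] L2_AE_cong[OF _ grad_meas[OF assms(2)] grad_AE_cong[OF assms(3)]]
  by (simp add: Fr_iff)

lemma E1_AE_cong:
  assumes "u \<in> Fr m k" "u' \<in> Fr m k" "AE x in m. u' x = u x"
  shows "E1 m k u' = E1 m k u"
proof -
  have "L2ip P (grad u') (grad u') = L2ip P (grad u) (grad u)" "L2ip m u' u' = L2ip m u u"
    using assms by (auto intro!: L2ip_AE_cong grad_AE_cong simp: Fr_iff)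
  then show ?thesis using assms by (simp add: E1_eq)
qed

text \<open>\<open>drift v\<close> carries \<open>v\<close> at the second point, so the first
  variable is integrated first. The hypothesis integrates over the second variable, but the quotient
  of the square of \<open>ka\<close> by \<open>ks\<close> is symmetric, so it applies with the roles
  exchanged.\<close>

lemma drift_L2:
  assumes v: "v \<in> L2 m"
  shows "drift v \<in> L2 P" and "L2ip P (drift v) (drift v) \<le> C * L2ip m v v"
proof -
  note [measurable] = L2_meas[OF v]
  have "(\<integral>\<^sup>+p. ennreal ((drift v p)\<^sup>2) \<partial>P) = (\<integral>\<^sup>+y. \<integral>\<^sup>+x. ennreal ((drift v (x, y))\<^sup>2) \<partial>m \<partial>m)"
    by (rule nn_integral_snd[symmetric]) measurable
  also have "\<dots> = (\<integral>\<^sup>+y. ennreal ((v y)\<^sup>2) * (\<integral>\<^sup>+x. ennreal ((ka k y x)\<^sup>2 / ks k y x) \<partial>m) \<partial>m)"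
  proof (rule nn_integral_cong)
    fix y assume [measurable]: "y \<in> space m"
    have "(drift v (x, y))\<^sup>2 = (v y)\<^sup>2 * ((ka k y x)\<^sup>2 / ks k y x)" for x
      using ka_commute[of x y] ks_commute[of x y] ks_nonneg[of y x]
      by (simp add: drift_def power_mult_distrib power_divide)
    then have "(\<integral>\<^sup>+x. ennreal ((drift v (x, y))\<^sup>2) \<partial>m) =
        (\<integral>\<^sup>+x. ennreal ((v y)\<^sup>2) * ennreal ((ka k y x)\<^sup>2 / ks k y x) \<partial>m)"
      by (simp add: ks_nonneg flip: ennreal_mult)
    also have "\<dots> = ennreal ((v y)\<^sup>2) * (\<integral>\<^sup>+x. ennreal ((ka k y x)\<^sup>2 / ks k y x) \<partial>m)"
      by (rule nn_integral_cmult) measurable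
    finally show "(\<integral>\<^sup>+x. ennreal ((drift v (x, y))\<^sup>2) \<partial>m) = \<dots>" .
  qed
  also have "\<dots> \<le> (\<integral>\<^sup>+y. ennreal ((v y)\<^sup>2) * ennreal C \<partial>m)"
    by (intro nn_integral_mono mult_left_mono ka_bound) simp
  also have "\<dots> = ennreal (C * L2ip m v v)"
    using C_nonneg
    by (simp add: nn_integral_multc nn_integral_square_L2[OF v] L2ip_nonneg ennreal_mult mult.commute[of C])
  finally have le: "(\<integral>\<^sup>+p. ennreal ((drift v p)\<^sup>2) \<partial>P) \<le> ennreal (C * L2ip m v v)" .
  show L: "drift v \<in> L2 P"
    using le by (intro L2_nn_integralI) (auto intro: le_less_trans)
  show "L2ip P (drift v) (drift v) \<le> C * L2ip m v v"
    using le C_nonneg by (simp add: nn_integral_square_L2[OF L] L2ip_nonneg)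
qed

section \<open>The form \<open>eta\<close>, its symmetrized density and its bounds\<close>

definition eta :: "('a \<Rightarrow> real) \<Rightarrow> ('a \<Rightarrow> real) \<Rightarrow> real" where
  "eta u v = L2ip P (grad u) (grad v) / 2 + L2ip P (grad u) (drift v)"

definition eta_density :: "('a \<Rightarrow> real) \<Rightarrow> ('a \<Rightarrow> real) \<Rightarrow> 'a \<times> 'a \<Rightarrow> real" where
  "eta_density u v p = (u (fst p) - u (snd p)) *
     (v (fst p) * k (fst p) (snd p) - v (snd p) * k (snd p) (fst p)) / 2"

text \<open>Inserting \<open>k = ks + ka\<close> leaves \<open>v x - v y\<close> as the factor of
  \<open>ks\<close> and \<open>v x + v y\<close> as the factor of \<open>ka x y\<close>. The two
  drift terms are the summands with \<open>v y\<close> and \<open>v x\<close>; the second keeps its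
  sign because both \<open>u x - u y\<close> and \<open>ka\<close> are antisymmetric.\<close>

lemma eta_density_eq:
  "eta_density u v (x, y) = (grad u (x, y) * grad v (x, y)) / 2 +
     (grad u (x, y) * drift v (x, y) + grad u (y, x) * drift v (y, x)) / 2"
  unfolding grad_mult_grad grad_mult_drift eta_density_def
  by (simp add: k_eq ks_commute[of y x] ka_commute[of y x] field_simps)

lemma eta_eq_integral_density:
  assumes "u \<in> Fr m k" "v \<in> Fr m k"
  shows "integrable P (eta_density u v)" and "(\<integral>p. eta_density u v p \<partial>P) = eta u v"
proof -
  have gg: "integrable P (\<lambda>p. grad u p * grad v p)"
    using assms by (auto simp: Fr_iff intro: L2_integrable_mult)
  have gd: "integrable P (\<lambda>p. grad u p * drift v p)"
    using assms by (auto simp: Fr_iff intro: L2_integrable_mult drift_L2)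
  have gd': "integrable P (\<lambda>(x, y). grad u (y, x) * drift v (y, x))"
    using integrable_product_swap[OF gd] by simp
  have swap: "(\<integral>(x, y). grad u (y, x) * drift v (y, x) \<partial>P) = (\<integral>p. grad u p * drift v p \<partial>P)"
    using integral_product_swap[OF borel_measurable_integrable[OF gd]] by simp
  have eq: "eta_density u v = (\<lambda>p. (grad u p * grad v p) / 2 +
      (grad u p * drift v p + (case p of (x, y) \<Rightarrow> grad u (y, x) * drift v (y, x))) / 2)"
    by (auto simp: fun_eq_iff eta_density_eq)
  show "integrable P (eta_density u v)"
    unfolding eq using gg gd gd' by simp
  show "(\<integral>p. eta_density u v p \<partial>P) = eta u v"
    unfolding eq eta_def L2ip_def using gg gd gd' swap by simp
qed

lemma eta_lincomb_left:
  assumes "u \<in> Fr m k" "v \<in> Fr m k" "w \<in> Fr m k"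
  shows "eta (\<lambda>x. a * u x + b * v x) w = a * eta u w + b * eta v w"
  using assms unfolding eta_def grad_lincomb
  by (subst (1 2) L2ip_lincomb_left) (auto simp: Fr_iff drift_L2 field_simps)

lemma eta_lincomb_right:
  assumes "u \<in> Fr m k" "v \<in> Fr m k" "w \<in> Fr m k"
  shows "eta w (\<lambda>x. a * u x + b * v x) = a * eta w u + b * eta w v"
  using assms unfolding eta_def grad_lincomb drift_lincomb
  by (subst (1 2) L2ip_lincomb_right) (auto simp: Fr_iff drift_L2 field_simps)

lemma eta_AE_cong:
  assumes "u \<in> Fr m k" "u' \<in> Fr m k" "v \<in> Fr m k" "v' \<in> Fr m k"
    and "AE x in m. u' x = u x" "AE x in m. v' x = v x"
  shows "eta u' v' = eta u v"
proof -
  have "L2ip P (grad u') (grad v') = L2ip P (grad u) (grad v)"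
    using assms by (intro L2ip_AE_cong grad_AE_cong) (auto simp: Fr_iff)
  moreover have "L2ip P (grad u') (drift v') = L2ip P (grad u) (drift v)"
    using assms by (intro L2ip_AE_cong grad_AE_cong drift_AE_cong drift_L2) (auto simp: Fr_iff)
  ultimately show ?thesis by (simp add: eta_def)
qed

lemma abs_grad_drift_le:
  assumes "u \<in> Fr m k" "v \<in> Fr m k"
  shows "\<bar>L2ip P (grad u) (drift v)\<bar> \<le> sqrt (L2ip P (grad u) (grad u)) * (sqrt C * sqrt (L2ip m v v))"
proof -
  have "\<bar>L2ip P (grad u) (drift v)\<bar> \<le> sqrt (L2ip P (grad u) (grad u)) * sqrt (L2ip P (drift v) (drift v))"
    using assms by (intro L2ip_Cauchy_Schwarz) (auto simp: Fr_iff drift_L2)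
  also have "\<dots> \<le> sqrt (L2ip P (grad u) (grad u)) * sqrt (C * L2ip m v v)"
    using assms by (intro mult_left_mono real_sqrt_le_mono drift_L2) (auto simp: Fr_iff L2ip_nonneg)
  finally show ?thesis by (simp add: real_sqrt_mult)
qed

abbreviation "alpha \<equiv> C + 1"

text \<open>Young's inequality. The weight 1/4 leaves a quarter of the gradient energy out of the
  half contained in \<open>eta u u\<close>, and the cost \<open>C * L2ip m u u\<close> is what
  \<open>alpha\<close> compensates, with one \<open>L2ip m u u\<close> to spare.\<close>

lemma abs_grad_drift_self_le:
  assumes "u \<in> Fr m k"
  shows "\<bar>L2ip P (grad u) (drift u)\<bar> \<le> L2ip P (grad u) (grad u) / 4 + C * L2ip m u u"
proof -
  define G S where "G = sqrt (L2ip P (grad u) (grad u))" and "S = sqrt C * sqrt (L2ip m u u)"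
  have "G\<^sup>2 = L2ip P (grad u) (grad u)" "S\<^sup>2 = C * L2ip m u u"
    by (simp_all add: G_def S_def power_mult_distrib L2ip_nonneg C_nonneg)
  moreover have "G * S \<le> G\<^sup>2 / 4 + S\<^sup>2"
    using zero_le_power2[of "G / 2 - S"] by (simp add: power2_diff power_divide)
  ultimately show ?thesis
    using abs_grad_drift_le[OF assms assms] by (simp add: G_def S_def)
qed

text \<open>What survives in \<open>eta u u + alpha * L2ip m u u\<close> is at least a quarter of
  the gradient energy plus the full squared norm of \<open>u\<close>.\<close>

lemma E1_le_eta:
  assumes "u \<in> Fr m k"
  shows "E1 m k u \<le> 4 * (eta u u + alpha * L2ip m u u)"
  using abs_grad_drift_self_le[OF assms] L2ip_nonneg[of m u]
  by (simp add: E1_eq[OF assms] eta_def algebra_simps abs_le_iff)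

text \<open>The gradient energy enters with at most 1/2 + 1/4, the squared norm with at most
  \<open>C + alpha = 2 * C + 1\<close>; the larger constant serves for both.\<close>

lemma eta_le_E1:
  assumes "u \<in> Fr m k"
  shows "eta u u + alpha * L2ip m u u \<le> (2 * C + 1) * E1 m k u"
proof -
  have "0 \<le> C * L2ip P (grad u) (grad u)" "0 \<le> L2ip P (grad u) (grad u)"
    using C_nonneg by (simp_all add: L2ip_nonneg)
  then show ?thesis
    using abs_grad_drift_self_le[OF assms] L2ip_nonneg[of m u]
    by (simp add: E1_eq[OF assms] eta_def algebra_simps abs_le_iff)
qed

lemma eta_alpha_nonneg: "u \<in> Fr m k \<Longrightarrow> 0 \<le> eta u u + alpha * L2ip m u u"
  using order_trans[OF E1_nonneg E1_le_eta, of u] by (simp only: zero_le_mult_iff) auto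

lemma form_norm_square:
  assumes "u \<in> Fr m k"
  shows "(form_norm m eta alpha u)\<^sup>2 = eta u u + alpha * L2ip m u u"
  unfolding form_norm_def by (intro real_sqrt_pow2 eta_alpha_nonneg assms)

lemma form_norm_nonneg: "u \<in> Fr m k \<Longrightarrow> 0 \<le> form_norm m eta alpha u"
  unfolding form_norm_def by (intro real_sqrt_ge_zero eta_alpha_nonneg)

lemma form_norm_le:
  assumes "u \<in> Fr m k"
  shows "form_norm m eta alpha u \<le> sqrt ((2 * C + 1) * E1 m k u)"
  unfolding form_norm_def by (intro real_sqrt_le_mono eta_le_E1 assms)

lemma eta_ge: "u \<in> Fr m k \<Longrightarrow> - alpha * L2ip m u u \<le> eta u u"
  using eta_alpha_nonneg[of u] by (simp add: algebra_simps)

text \<open>Against the form norm, the gradient norm costs a factor 2 and the norm of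
  \<open>v\<close> a factor 1. The symmetric half then contributes 2 and the drift
  \<open>2 * sqrt C\<close>.\<close>

lemma eta_sector:
  assumes u: "u \<in> Fr m k" and v: "v \<in> Fr m k"
  shows "eta u v \<le> (2 + 2 * sqrt C) * form_norm m eta alpha u * form_norm m eta alpha v"
proof -
  let ?N = "form_norm m eta alpha"
  let ?G = "\<lambda>u. sqrt (L2ip P (grad u) (grad u))"
  have G: "?G w \<le> 2 * ?N w" if "w \<in> Fr m k" for w
  proof -
    have "(?G w)\<^sup>2 \<le> (2 * ?N w)\<^sup>2"
      unfolding power_mult_distrib form_norm_square[OF that]
      using E1_le_eta[OF that] L2ip_nonneg[of m w] L2ip_nonneg[of P "grad w"]
      by (simp add: E1_eq[OF that])
    then show ?thesis
      by (rule power2_le_imp_le) (simp add: form_norm_nonneg[OF that])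
  qed
  have S: "sqrt (L2ip m v v) \<le> ?N v"
  proof -
    have "L2ip P (grad v) (grad v) \<ge> 0" by (rule L2ip_nonneg)
    then have "L2ip m v v \<le> eta v v + alpha * L2ip m v v"
      using abs_grad_drift_self_le[OF v] L2ip_nonneg[of m v]
      by (simp add: eta_def algebra_simps abs_le_iff)
    then show ?thesis unfolding form_norm_def by (rule real_sqrt_le_mono)
  qed
  have nn: "0 \<le> ?N u" "0 \<le> ?N v"
    using u v by (simp_all add: form_norm_nonneg)
  have "eta u v \<le> \<bar>L2ip P (grad u) (grad v)\<bar> / 2 + \<bar>L2ip P (grad u) (drift v)\<bar>"
    by (simp add: eta_def add_mono)
  also have "\<dots> \<le> ?G u * ?G v / 2 + ?G u * (sqrt C * sqrt (L2ip m v v))"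
    using u v by (intro add_mono divide_right_mono L2ip_Cauchy_Schwarz abs_grad_drift_le) (auto simp: Fr_iff)
  also have "\<dots> \<le> (2 * ?N u) * (2 * ?N v) / 2 + (2 * ?N u) * (sqrt C * ?N v)"
    using G[OF u] G[OF v] S nn C_nonneg
    by (intro add_mono divide_right_mono mult_mono mult_left_mono) (auto simp: L2ip_nonneg)
  also have "\<dots> = (2 + 2 * sqrt C) * ?N u * ?N v"
    by (simp add: algebra_simps)
  finally show ?thesis .
qed

end

subsection \<open>Lipschitz functions with compact support\<close>

lemma Cc_lipI:
  fixes u :: "'a::metric_space \<Rightarrow> real"
  assumes lip: "L-lipschitz_on UNIV u" and K: "compact K" and supp: "\<And>x. u x \<noteq> 0 \<Longrightarrow> x \<in> K"
  shows "u \<in> Cc_lip"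
proof -
  have "closure {x. u x \<noteq> 0} \<subseteq> K"
    using supp by (intro closure_minimal compact_imp_closed K) auto
  then have "compact (closure {x. u x \<noteq> 0})"
    using compact_Int_closed[OF K closed_closure, of "{x. u x \<noteq> 0}"] by (simp add: Int_absorb1)
  then show ?thesis using lip by (auto simp: Cc_lip_def)
qed

lemma Cc_bounded:
  fixes u :: "'a::metric_space \<Rightarrow> real"
  assumes "u \<in> Cc"
  obtains B where "0 \<le> B" "\<And>x. \<bar>u x\<bar> \<le> B"
proof -
  have "compact (u ` closure {x. u x \<noteq> 0})"
    using assms by (intro compact_continuous_image) (auto simp: Cc_def intro: continuous_on_subset)
  then obtain B where B: "\<And>x. x \<in> closure {x. u x \<noteq> 0} \<Longrightarrow> \<bar>u x\<bar> \<le> B"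
    using compact_imp_bounded by (fastforce simp: bounded_iff)
  \<comment> \<open>The maximum with 0 covers an empty support, for which \<open>B\<close> may be
    negative.\<close>
  have "\<bar>u x\<bar> \<le> max B 0" for x
  proof (cases "u x = 0")
    case False
    then have "x \<in> closure {x. u x \<noteq> 0}"
      by (intro subsetD[OF closure_subset]) simp
    then show ?thesis using B by (simp add: max.coboundedI1)
  qed simp
  then show ?thesis by (intro that[of "max B 0"]) auto
qed

lemma Cc_lip_subset_Cc: "Cc_lip \<subseteq> Cc"
  by (auto simp: Cc_lip_def Cc_def intro: lipschitz_on_continuous_on)

lemma Cc_lipE:
  fixes u :: "'a::metric_space \<Rightarrow> real"
  assumes u: "u \<in> Cc_lip"
  obtains L K B where "L-lipschitz_on UNIV u" "compact K" "\<And>x. x \<notin> K \<Longrightarrow> u x = 0"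
    "0 \<le> B" "\<And>x. \<bar>u x\<bar> \<le> B"
proof -
  obtain L where L: "L-lipschitz_on UNIV u" using u by (auto simp: Cc_lip_def)
  obtain B where B: "0 \<le> B" "\<And>x. \<bar>u x\<bar> \<le> B"
    using Cc_bounded[of u] u Cc_lip_subset_Cc by (metis subsetD)
  show ?thesis
  proof (rule that[OF L _ _ B])
    show "compact (closure {x. u x \<noteq> 0})" using u by (simp add: Cc_lip_def)
    show "u x = 0" if "x \<notin> closure {x. u x \<noteq> 0}" for x
      using that closure_subset[of "{x. u x \<noteq> 0}"] by auto
  qed
qed

lemma Cc_lip_lincomb:
  fixes u :: "'a::metric_space \<Rightarrow> real"
  assumes u: "u \<in> Cc_lip" and v: "v \<in> Cc_lip"
  shows "(\<lambda>x. a * u x + b * v x) \<in> Cc_lip"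
proof -
  obtain L K where 1: "L-lipschitz_on UNIV u" "compact K" "\<And>x. x \<notin> K \<Longrightarrow> u x = 0"
    using Cc_lipE[OF u] by metis
  obtain L' K' where 2: "L'-lipschitz_on UNIV v" "compact K'" "\<And>x. x \<notin> K' \<Longrightarrow> v x = 0"
    using Cc_lipE[OF v] by metis
  show ?thesis
  proof (rule Cc_lipI)
    show "(\<bar>a\<bar> * L + \<bar>b\<bar> * L')-lipschitz_on UNIV (\<lambda>x. a * u x + b * v x)"
      by (intro lipschitz_on_add lipschitz_on_cmult_real 1 2)
    show "compact (K \<union> K')" by (intro compact_Un 1 2)
    show "x \<in> K \<union> K'" if nz: "a * u x + b * v x \<noteq> 0" for x
    proof (rule ccontr)
      assume "x \<notin> K \<union> K'"
      then show False using nz 1(3)[of x] 2(3)[of x] by simp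
    qed
  qed
qed

lemma Cc_lip_contraction:
  fixes u :: "'a::metric_space \<Rightarrow> real"
  assumes u: "u \<in> Cc_lip" and T: "\<And>s t. \<bar>T s - T t\<bar> \<le> \<bar>s - t\<bar>" "T 0 = 0"
  shows "(\<lambda>x. T (u x)) \<in> Cc_lip"
proof -
  obtain L K where *: "L-lipschitz_on UNIV u" "compact K" "\<And>x. x \<notin> K \<Longrightarrow> u x = 0"
    using Cc_lipE[OF u] by metis
  show ?thesis
  proof (rule Cc_lipI)
    have "\<bar>T (u x) - T (u y)\<bar> \<le> L * dist x y" for x y
      using T(1)[of "u x" "u y"] lipschitz_onD[OF *(1), of x y] by (simp add: dist_real_def)
    then show "L-lipschitz_on UNIV (\<lambda>x. T (u x))"
      using lipschitz_on_nonneg[OF *(1)] by (intro lipschitz_onI) (auto simp: dist_real_def)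
    show "x \<in> K" if nz: "T (u x) \<noteq> 0" for x
      using nz *(3)[of x] T(2) by (cases "x \<in> K") simp_all
    show "compact K" by fact
  qed
qed

lemma unit_contraction_le: "\<bar>min (max s 0) 1 - min (max t 0) 1\<bar> \<le> \<bar>s - t\<bar>" for s t :: real
  by (auto simp: min_def max_def)

subsection \<open>The limit of the truncated forms and the domain\<close>

context jump_form
begin

lemma borel_measurable_m: "borel_measurable m = borel_measurable borel"
  by (rule measurable_cong_sets) (simp_all add: sets_m)

lemma Cc_lip_meas: "u \<in> Cc_lip \<Longrightarrow> u \<in> borel_measurable m"
  using Cc_lip_subset_Cc unfolding borel_measurable_m
  by (intro borel_measurable_continuous_onI) (auto simp: Cc_def)

lemma compact_sets: "compact K \<Longrightarrow> K \<in> sets m"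
  by (simp add: sets_m borel_compact)

text \<open>The integrand of the local integrability hypothesis with the first point confined to
  \<open>K\<close>: the common majorant for squared gradients and for the integrands of
  \<open>eta_n\<close>.\<close>

definition trunc_kernel :: "'a set \<Rightarrow> 'a \<times> 'a \<Rightarrow> real" where
  "trunc_kernel K p =
     indicator K (fst p) * (min 1 ((dist (fst p) (snd p))\<^sup>2) * ks k (fst p) (snd p))"

lemma trunc_kernel_nonneg: "0 \<le> trunc_kernel K p"
  by (simp add: trunc_kernel_def ks_nonneg)

lemma integrable_trunc_kernel:
  assumes K: "compact K"
  shows "integrable P (trunc_kernel K)"
proof (rule integrableI_nonneg)
  note [measurable] = compact_sets[OF K]
  show meas [measurable]: "trunc_kernel K \<in> borel_measurable P"
    unfolding trunc_kernel_def by measurable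
  show "AE p in P. 0 \<le> trunc_kernel K p"
    by (simp add: trunc_kernel_nonneg)
  have "(\<integral>\<^sup>+p. ennreal (trunc_kernel K p) \<partial>P) = (\<integral>\<^sup>+x. \<integral>\<^sup>+y. ennreal (trunc_kernel K (x, y)) \<partial>m \<partial>m)"
    by (rule base.nn_integral_fst[symmetric]) measurable
  also have "\<dots> = (\<integral>\<^sup>+x\<in>K. (\<integral>\<^sup>+y. ennreal (min 1 ((dist x y)\<^sup>2) * ks k x y) \<partial>m) \<partial>m)"
    by (intro nn_integral_cong) (auto simp: trunc_kernel_def split: split_indicator)
  also have "\<dots> < \<infinity>" by (rule L1loc[OF K])
  finally show "(\<integral>\<^sup>+p. ennreal (trunc_kernel K p) \<partial>P) < \<infinity>" .
qed

lemma Cc_lip_L2: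
  assumes u: "u \<in> Cc_lip"
  shows "u \<in> L2 m"
proof -
  obtain K B where K: "compact K" "\<And>x. x \<notin> K \<Longrightarrow> u x = 0" "\<And>x. \<bar>u x\<bar> \<le> B"
    using Cc_lipE[OF u] by metis
  note [measurable] = Cc_lip_meas[OF u]
  have "integrable m (\<lambda>x. (u x)\<^sup>2)"
  proof (rule integrableI_bounded_set[where A=K and B="B\<^sup>2"])
    have "\<bar>u x\<bar>\<^sup>2 \<le> B\<^sup>2" for x by (rule power_mono) (simp_all add: K)
    then show "AE x in m. x \<in> K \<longrightarrow> norm ((u x)\<^sup>2) \<le> B\<^sup>2" by simp
    show "emeasure m K < \<infinity>" by (rule emeasure_compact[OF K(1)])
  qed (auto simp: compact_sets K)
  then show ?thesis by (simp add: L2_def)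
qed

text \<open>The Lipschitz bound controls increments at distance at most 1 and boundedness controls
  the others. The gradient vanishes unless one of the two points lies in \<open>K\<close>; since
  \<open>trunc_kernel K\<close> confines only the first point, its reflection is added to the
  majorant.\<close>

lemma Cc_lip_Fr:
  assumes u: "u \<in> Cc_lip"
  shows "u \<in> Fr m k"
proof -
  obtain L K B where L: "L-lipschitz_on UNIV u" and K: "compact K" "\<And>x. x \<notin> K \<Longrightarrow> u x = 0"
    and B: "\<And>x. \<bar>u x\<bar> \<le> B"
    using Cc_lipE[OF u] by metis
  note [measurable] = Cc_lip_meas[OF u]
  let ?c = "L\<^sup>2 + 4 * B\<^sup>2"
  have du: "(u x - u y)\<^sup>2 \<le> ?c * min 1 ((dist x y)\<^sup>2)" for x y
  proof (cases "(dist x y)\<^sup>2 \<le> 1")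
    case True
    have "\<bar>u x - u y\<bar>\<^sup>2 \<le> (L * dist x y)\<^sup>2"
      using lipschitz_onD[OF L, of x y] by (intro power_mono) (auto simp: dist_real_def)
    also have "\<dots> \<le> ?c * (dist x y)\<^sup>2"
      by (simp add: power_mult_distrib mult_right_mono)
    finally show ?thesis using True by simp
  next
    case False
    have "\<bar>u x - u y\<bar>\<^sup>2 \<le> (2 * B)\<^sup>2"
      using B[of x] B[of y] by (intro power_mono) auto
    also have "\<dots> \<le> ?c" by (simp add: power_mult_distrib)
    finally show ?thesis using False by simp
  qed
  have "integrable P (\<lambda>p. ?c * (trunc_kernel K p + (case p of (x, y) \<Rightarrow> trunc_kernel K (y, x))))"
    using integrable_trunc_kernel[OF K(1)] integrable_product_swap[OF integrable_trunc_kernel[OF K(1)]]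
    by simp
  then have "integrable P (\<lambda>p. (grad u p)\<^sup>2)"
  proof (rule Bochner_Integration.integrable_bound)
    show "AE p in P. norm ((grad u p)\<^sup>2) \<le>
        norm (?c * (trunc_kernel K p + (case p of (x, y) \<Rightarrow> trunc_kernel K (y, x))))"
    proof (rule AE_I2, clarify)
      fix x y
      have "(grad u (x, y))\<^sup>2 \<le> ?c * (trunc_kernel K (x, y) + trunc_kernel K (y, x))"
      proof (cases "x \<in> K \<or> y \<in> K")
        case True
        have "(grad u (x, y))\<^sup>2 \<le> ?c * (min 1 ((dist x y)\<^sup>2) * ks k x y)"
          using mult_right_mono[OF du ks_nonneg, of x y x y] by (simp add: grad_square mult.assoc)
        also have "\<dots> \<le> ?c * (trunc_kernel K (x, y) + trunc_kernel K (y, x))"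
          using True ks_nonneg[of x y]
          by (intro mult_left_mono) (auto simp: trunc_kernel_def dist_commute ks_commute split: split_indicator)
        finally show ?thesis .
      next
        case False
        then have "grad u (x, y) = 0" by (simp add: grad_def K)
        then show ?thesis by (simp add: trunc_kernel_nonneg)
      qed
      then show "norm ((grad u (x, y))\<^sup>2) \<le> norm (?c * (trunc_kernel K (x, y) + trunc_kernel K (y, x)))"
        by (simp add: trunc_kernel_nonneg abs_mult)
    qed
  qed measurable
  then have "grad u \<in> L2 P" by (simp add: L2_def)
  then show ?thesis using Cc_lip_L2[OF u] by (simp add: Fr_iff)
qed

text \<open>Away from the diagonal the kernel is integrable over \<open>K\<close> times the space,
  so Fubini's theorem and the reflection of the two variables apply. For \<open>n = 0\<close> the
  convention 1/0 = 0 would leave no distance from the diagonal.\<close>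

lemma eta_n_eq_integral_density:
  assumes u: "u \<in> Cc_lip" and v: "v \<in> Cc_lip" and n: "1 \<le> n"
  shows "eta_n m k n u v =
    (\<integral>p. indicator {p. 1 / real n < dist (fst p) (snd p)} p * eta_density u v p \<partial>P)"
proof -
  obtain Bu where Bu: "\<And>x. \<bar>u x\<bar> \<le> Bu" "0 \<le> Bu" using Cc_lipE[OF u] by metis
  obtain Bv K where Bv: "\<And>x. \<bar>v x\<bar> \<le> Bv" "0 \<le> Bv" and K: "compact K" "\<And>x. x \<notin> K \<Longrightarrow> v x = 0"
    using Cc_lipE[OF v] by metis
  note [measurable] = Cc_lip_meas[OF u] Cc_lip_meas[OF v]
  define I :: "'a \<times> 'a \<Rightarrow> real" where "I p = indicator {p. 1 / real n < dist (fst p) (snd p)} p" for p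
  have I_eq: "I p = (if 1 / real n < dist (fst p) (snd p) then 1 else 0)" for p
    by (simp add: I_def)
  have [measurable]: "I \<in> borel_measurable P"
    unfolding I_eq[abs_def] by measurable
  have I_swap: "I (y, x) = I (x, y)" for x y
    by (simp add: I_eq dist_commute)
  \<comment> \<open>Here \<open>v\<close> sits at the first point, as in \<open>eta_n\<close>, so
    \<open>h\<close> vanishes unless that point lies in \<open>K\<close>.\<close>
  define h where "h p = I p * ((u (fst p) - u (snd p)) * v (fst p) * k (fst p) (snd p))" for p
  have [measurable]: "h \<in> borel_measurable P"
    unfolding h_def by measurable
  \<comment> \<open>Increments of \<open>u\<close> are at most \<open>2 * Bu\<close>,
    \<open>k\<close> is at most \<open>2 * ks\<close>, and on the truncated region the square of
    \<open>n\<close> makes up for the factor \<open>min 1 ((dist x y)\<^sup>2)\<close>.\<close>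
  have "integrable P (\<lambda>p. (4 * Bu * Bv * (real n)\<^sup>2) * trunc_kernel K p)"
    using integrable_trunc_kernel[OF K(1)] by simp
  then have h: "integrable P h"
  proof (rule Bochner_Integration.integrable_bound)
    show "AE p in P. norm (h p) \<le> norm ((4 * Bu * Bv * (real n)\<^sup>2) * trunc_kernel K p)"
    proof (rule AE_I2, clarify)
      fix x y
      have "\<bar>h (x, y)\<bar> \<le> (4 * Bu * Bv * (real n)\<^sup>2) * trunc_kernel K (x, y)"
      proof (cases "x \<in> K \<and> 1 / real n < dist x y")
        case True
        have "1 / real n * real n \<le> dist x y * real n"
          using True by (intro mult_right_mono) auto
        then have "1 \<le> real n * dist x y" using n by (simp add: mult.commute)
        then have "1 \<le> (real n)\<^sup>2 * (dist x y)\<^sup>2"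
          by (simp flip: power_mult_distrib)
        moreover have "1 \<le> (real n)\<^sup>2" using n by simp
        ultimately have mn: "1 \<le> (real n)\<^sup>2 * min 1 ((dist x y)\<^sup>2)"
          by (simp add: min_def)
        have "\<bar>h (x, y)\<bar> = \<bar>u x - u y\<bar> * \<bar>v x\<bar> * k x y"
          using True by (simp add: h_def I_eq abs_mult k_nonneg)
        also have "\<dots> \<le> (2 * Bu) * Bv * (2 * ks k x y)"
          using Bu(1)[of x] Bu(1)[of y] Bu(2) Bv k_le k_nonneg by (intro mult_mono) auto
        also have "\<dots> = (4 * Bu * Bv * ks k x y) * 1" by simp
        also have "\<dots> \<le> (4 * Bu * Bv * ks k x y) * ((real n)\<^sup>2 * min 1 ((dist x y)\<^sup>2))"
          using Bu(2) Bv(2) ks_nonneg[of x y] by (intro mult_left_mono mn) simp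
        also have "\<dots> = (4 * Bu * Bv * (real n)\<^sup>2) * trunc_kernel K (x, y)"
          using True by (simp add: trunc_kernel_def)
        finally show ?thesis .
      next
        case False
        then have "h (x, y) = 0" by (auto simp: h_def I_eq K)
        then show ?thesis using Bu(2) Bv(2) by (simp add: trunc_kernel_nonneg)
      qed
      then show "norm (h (x, y)) \<le> norm ((4 * Bu * Bv * (real n)\<^sup>2) * trunc_kernel K (x, y))"
        by simp
    qed
  qed measurable
  have "- (Ln m k n u x * v x) = (\<integral>y. h (x, y) \<partial>m)" for x
  proof -
    have "- (Ln m k n u x * v x) =
        (\<integral>y. indicator {y. 1 / real n < dist x y} y * ((u y - u x) * k x y) * - v x \<partial>m)"
      by (simp add: Ln_def)
    also have "\<dots> = (\<integral>y. h (x, y) \<partial>m)"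
      by (intro Bochner_Integration.integral_cong refl) (auto simp: h_def I_eq algebra_simps split: split_indicator)
    finally show ?thesis .
  qed
  then have "eta_n m k n u v = (\<integral>x. \<integral>y. h (x, y) \<partial>m \<partial>m)"
    by (simp add: eta_n_def L2ip_def flip: Bochner_Integration.integral_minus)
  also have "\<dots> = (\<integral>p. h p \<partial>P)" by (rule integral_fst'[OF h])
  also have "\<dots> = (\<integral>p. (h p + (case p of (x, y) \<Rightarrow> h (y, x))) / 2 \<partial>P)"
    using integrable_product_swap[OF h] integral_product_swap[of h] h by simp
  also have "\<dots> = (\<integral>p. I p * eta_density u v p \<partial>P)"
  proof (rule Bochner_Integration.integral_cong[OF refl], clarify)
    fix x y
    show "(h (x, y) + h (y, x)) / 2 = I (x, y) * eta_density u v (x, y)"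
      by (simp add: h_def eta_density_def I_swap[of x y] algebra_simps add_divide_distrib diff_divide_distrib)
  qed
  finally show ?thesis by (simp add: I_def)
qed

lemma eta_n_tendsto:
  assumes u: "u \<in> Cc_lip" and v: "v \<in> Cc_lip"
  shows "(\<lambda>n. eta_n m k n u v) \<longlonglongrightarrow> eta u v"
proof -
  note dens = eta_eq_integral_density[OF Cc_lip_Fr[OF u] Cc_lip_Fr[OF v]]
  note [measurable] = borel_measurable_integrable[OF dens(1)]
  define I :: "nat \<Rightarrow> 'a \<times> 'a \<Rightarrow> real" where "I n p = indicator {p. 1 / real n < dist (fst p) (snd p)} p" for n p
  have I_eq: "I n p = (if 1 / real n < dist (fst p) (snd p) then 1 else 0)" for n p
    by (simp add: I_def)
  have [measurable]: "I n \<in> borel_measurable P" for n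
    unfolding I_eq[abs_def] by measurable
  have "(\<lambda>n. \<integral>p. I n p * eta_density u v p \<partial>P) \<longlonglongrightarrow> (\<integral>p. eta_density u v p \<partial>P)"
  proof (rule integral_dominated_convergence)
    show "integrable P (\<lambda>p. \<bar>eta_density u v p\<bar>)" using dens(1) by simp
    show "AE p in P. norm (I n p * eta_density u v p) \<le> \<bar>eta_density u v p\<bar>" for n
      by (simp add: I_eq)
    show "AE p in P. (\<lambda>n. I n p * eta_density u v p) \<longlonglongrightarrow> eta_density u v p"
    proof (rule AE_I2, clarify)
      fix x y
      show "(\<lambda>n. I n (x, y) * eta_density u v (x, y)) \<longlonglongrightarrow> eta_density u v (x, y)"
      \<comment> \<open>On the diagonal the indicator stays 0 for all \<open>n\<close>, but the
        density is 0 there as well.\<close>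
      proof (cases "x = y")
        case True
        then show ?thesis by (simp add: eta_density_def)
      next
        case False
        then have "0 < dist x y" by simp
        then have "\<forall>\<^sub>F n in sequentially. 1 / real n < dist x y"
          using order_tendstoD(2)[OF lim_1_over_n[where 'a=real], of "dist x y"] by simp
        then have "\<forall>\<^sub>F n in sequentially. I n (x, y) * eta_density u v (x, y) = eta_density u v (x, y)"
          by eventually_elim (simp add: I_eq)
        then show ?thesis by (rule tendsto_eventually)
      qed
    qed
  qed measurable
  \<comment> \<open>The two sequences are identified only from \<open>n = 1\<close> on.\<close>
  moreover have "\<forall>\<^sub>F n in sequentially. (\<integral>p. I n p * eta_density u v p \<partial>P) = eta_n m k n u v"
    using eventually_ge_at_top[of 1]
    by eventually_elim (simp add: I_def eta_n_eq_integral_density[OF u v])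
  ultimately show ?thesis
    unfolding dens(2) by (rule Lim_transform_eventually)
qed

lemma grad_drift_integrable:
  assumes "u \<in> Fr m k" "v \<in> Fr m k"
  shows "integrable P (\<lambda>p. indicator {p. fst p \<noteq> snd p} p *
    ((u (fst p) - u (snd p)) * v (snd p) * ka k (fst p) (snd p)))"
proof -
  have "(\<lambda>p. indicator {p. fst p \<noteq> snd p} p * ((u (fst p) - u (snd p)) * v (snd p) * ka k (fst p) (snd p)))
      = (\<lambda>p. grad u p * drift v p)"
    unfolding grad_mult_drift by (auto simp: fun_eq_iff split: split_indicator)
  then show ?thesis
    using assms by (auto simp: Fr_iff intro: L2_integrable_mult drift_L2)
qed

lemma eta_eq:
  assumes "u \<in> Fr m k" "v \<in> Fr m k"
  shows "eta u v = Eform m k u v / 2 +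
    (\<integral>x. (\<integral>y. indicator {y. y \<noteq> x} y * ((u x - u y) * v y * ka k x y) \<partial>m) \<partial>m)"
proof -
  have "(\<integral>x. (\<integral>y. indicator {y. y \<noteq> x} y * ((u x - u y) * v y * ka k x y) \<partial>m) \<partial>m) =
      (\<integral>x. \<integral>y. grad u (x, y) * drift v (x, y) \<partial>m \<partial>m)"
    unfolding grad_mult_drift
    by (intro Bochner_Integration.integral_cong refl) (auto split: split_indicator)
  also have "\<dots> = L2ip P (grad u) (drift v)"
    unfolding L2ip_def using assms
    by (intro integral_fst' L2_integrable_mult) (auto simp: Fr_iff drift_L2)
  finally show ?thesis
    using assms by (simp add: eta_def Eform_eq_grad)
qed

text \<open>The density of \<open>\<eta>(w, u - w)\<close> is pointwise nonnegative: \<open>w(x) = 1\<close> is maximal where \<open>u > w\<close>,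
  and \<open>w(x) = 0\<close> is minimal where \<open>u < w\<close>.\<close>
lemma eta_unit_contraction_nonneg:
  assumes u: "u \<in> Fr m k" and w: "(\<lambda>x. min (max (u x) 0) 1) \<in> Fr m k"
  shows "0 \<le> eta (\<lambda>x. min (max (u x) 0) 1) (\<lambda>x. u x - min (max (u x) 0) 1)"
proof -
  define T where "T s = min (max s 0) (1::real)" for s
  have T: "0 \<le> (T s - T t) * (s - T s)" for s t
  proof -
    consider "s < 0" | "0 \<le> s" "s \<le> 1" | "1 < s" by linarith
    then show ?thesis
    proof cases
      case 1
      then show ?thesis by (intro mult_nonpos_nonpos) (auto simp: T_def)
    next
      case 3
      then show ?thesis by (intro mult_nonneg_nonneg) (auto simp: T_def)
    qed (simp add: T_def)
  qed
  have "0 \<le> eta_density (\<lambda>x. T (u x)) (\<lambda>x. u x - T (u x)) p" for p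
  proof -
    obtain x y where p: "p = (x, y)" by (cases p)
    have "0 \<le> (T (u x) - T (u y)) * (u x - T (u x)) * k x y"
      "0 \<le> (T (u y) - T (u x)) * (u y - T (u y)) * k y x"
      by (intro mult_nonneg_nonneg T k_nonneg)+
    then show ?thesis by (simp add: p eta_density_def algebra_simps)
  qed
  then have "0 \<le> eta (\<lambda>x. T (u x)) (\<lambda>x. u x - T (u x))"
    using eta_eq_integral_density(2)[OF w Fr_diff[OF u w]]
    by (simp flip: T_def) (metis integral_nonneg_AE AE_I2)
  then show ?thesis by (simp add: T_def)
qed

section \<open>The domain \<open>F0 m k\<close>: closedness, linearity, truncation and
  completeness\<close>

lemma F0_Fr: "u \<in> F0 m k \<Longrightarrow> u \<in> Fr m k"
  by (simp add: F0_def)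

text \<open>In this epsilon form approximations can be composed without choosing diagonal
  sequences.\<close>

lemma F0_iff:
  "u \<in> F0 m k \<longleftrightarrow> u \<in> Fr m k \<and> (\<forall>e>0. \<exists>f\<in>Cc_lip. E1 m k (\<lambda>x. f x - u x) < e)"
proof
  assume u: "u \<in> F0 m k"
  then obtain f where f: "\<And>i. f i \<in> Cc_lip" "(\<lambda>i. E1 m k (\<lambda>x. f i x - u x)) \<longlonglongrightarrow> 0"
    by (auto simp: F0_def)
  have "\<exists>f\<in>Cc_lip. E1 m k (\<lambda>x. f x - u x) < e" if "e > 0" for e
    using eventually_happens[OF order_tendstoD(2)[OF f(2) that]] f(1) by auto
  then show "u \<in> Fr m k \<and> (\<forall>e>0. \<exists>f\<in>Cc_lip. E1 m k (\<lambda>x. f x - u x) < e)"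
    using F0_Fr[OF u] by blast
next
  assume u: "u \<in> Fr m k \<and> (\<forall>e>0. \<exists>f\<in>Cc_lip. E1 m k (\<lambda>x. f x - u x) < e)"
  then have "\<forall>i. \<exists>f\<in>Cc_lip. E1 m k (\<lambda>x. f x - u x) < 1 / real (Suc i)" by simp
  then obtain f where f: "\<And>i. f i \<in> Cc_lip" "\<And>i. E1 m k (\<lambda>x. f i x - u x) < 1 / real (Suc i)"
    by metis
  have "(\<lambda>i. E1 m k (\<lambda>x. f i x - u x)) \<longlonglongrightarrow> 0"
  proof (rule tendsto_sandwich[OF _ _ tendsto_const LIMSEQ_inverse_real_of_nat])
    show "\<forall>\<^sub>F i in sequentially. 0 \<le> E1 m k (\<lambda>x. f i x - u x)"
      using u by (intro always_eventually allI E1_nonneg Fr_diff Cc_lip_Fr[OF f(1)]) simp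
    show "\<forall>\<^sub>F i in sequentially. E1 m k (\<lambda>x. f i x - u x) \<le> inverse (real (Suc i))"
      using f(2) by (intro always_eventually allI) (simp add: less_imp_le inverse_eq_divide)
  qed
  then show "u \<in> F0 m k" using u f(1) by (auto simp: F0_def)
qed

lemma Cc_lip_F0:
  assumes u: "u \<in> Cc_lip"
  shows "u \<in> F0 m k"
proof -
  have "E1 m k (\<lambda>x. u x - u x) = 0" by (simp add: E1_def Eform_def L2ip_def)
  then have "\<forall>e>0. \<exists>f\<in>Cc_lip. E1 m k (\<lambda>x. f x - u x) < e"
    using u by (intro allI impI bexI[of _ u]) simp_all
  then show ?thesis using Cc_lip_Fr[OF u] by (simp add: F0_iff)
qed

lemma F0_closed:
  assumes g: "g \<in> Fr m k" and approx: "\<And>e. 0 < e \<Longrightarrow> \<exists>f\<in>F0 m k. E1 m k (\<lambda>x. f x - g x) < e"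
  shows "g \<in> F0 m k"
  unfolding F0_iff
proof (intro conjI allI impI g)
  fix e :: real assume e: "0 < e"
  \<comment> \<open>\<open>E1\<close> is a squared norm: \<open>E1_diff_le\<close> doubles each of
    the two errors, so quarters of \<open>e\<close> are needed.\<close>
  then obtain f where f: "f \<in> F0 m k" "E1 m k (\<lambda>x. f x - g x) < e / 4"
    using approx[of "e / 4"] by auto
  then obtain h where h: "h \<in> Cc_lip" "E1 m k (\<lambda>x. h x - f x) < e / 4"
    using e unfolding F0_iff by (meson zero_less_divide_iff zero_less_numeral)
  have "E1 m k (\<lambda>x. (h x - f x) - (g x - f x)) \<le> 2 * E1 m k (\<lambda>x. h x - f x) + 2 * E1 m k (\<lambda>x. g x - f x)"
    using f h g by (intro E1_diff_le Fr_diff) (auto simp: F0_Fr Cc_lip_Fr)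
  then have "E1 m k (\<lambda>x. h x - g x) < e"
    using h f E1_minus_commute[of g f] by simp
  with h show "\<exists>f\<in>Cc_lip. E1 m k (\<lambda>x. f x - g x) < e" by blast
qed

lemma F0_lincomb:
  assumes u: "u \<in> F0 m k" and v: "v \<in> F0 m k"
  shows "(\<lambda>x. a * u x + b * v x) \<in> F0 m k"
  unfolding F0_iff
proof (intro conjI allI impI)
  show "(\<lambda>x. a * u x + b * v x) \<in> Fr m k"
    using u v by (intro Fr_lincomb F0_Fr)
  fix e :: real assume e: "0 < e"
  \<comment> \<open>The error will be at most \<open>2 * (a\<^sup>2 + b\<^sup>2) * d\<close>; the
    summand 1 keeps the denominator positive for \<open>a = b = 0\<close> and makes the final
    inequality strict.\<close>
  define d where "d = e / (2 * (a\<^sup>2 + b\<^sup>2 + 1))"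
  have pos: "0 < a\<^sup>2 + b\<^sup>2 + 1" by (simp add: add_nonneg_pos)
  then have d: "0 < d" using e by (simp add: d_def)
  obtain f where f: "f \<in> Cc_lip" "E1 m k (\<lambda>x. f x - u x) < d" using u d F0_iff by blast
  obtain g where g: "g \<in> Cc_lip" "E1 m k (\<lambda>x. g x - v x) < d" using v d F0_iff by blast
  have F: "(\<lambda>x. f x - u x) \<in> Fr m k" "(\<lambda>x. g x - v x) \<in> Fr m k"
    by (intro Fr_diff Cc_lip_Fr[OF f(1)] Cc_lip_Fr[OF g(1)] F0_Fr[OF u] F0_Fr[OF v])+
  \<comment> \<open>The sign of \<open>b\<close> is flipped so that the sum of the errors becomes a
    difference, as \<open>E1_diff_le\<close> requires.\<close>
  have F': "(\<lambda>x. a * (f x - u x)) \<in> Fr m k" "(\<lambda>x. (- b) * (g x - v x)) \<in> Fr m k"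
    using Fr_lincomb[OF F(1) F(1), of a 0] Fr_lincomb[OF F(2) F(2), of "- b" 0] by simp_all
  have "E1 m k (\<lambda>x. (a * f x + b * g x) - (a * u x + b * v x)) =
      E1 m k (\<lambda>x. a * (f x - u x) - (- b) * (g x - v x))"
    by (simp add: algebra_simps)
  also have "\<dots> \<le> 2 * E1 m k (\<lambda>x. a * (f x - u x)) + 2 * E1 m k (\<lambda>x. (- b) * (g x - v x))"
    by (rule E1_diff_le[OF F'])
  also have "\<dots> = 2 * (a\<^sup>2 * E1 m k (\<lambda>x. f x - u x)) + 2 * (b\<^sup>2 * E1 m k (\<lambda>x. g x - v x))"
    unfolding E1_mult[OF F(1)] E1_mult[OF F(2)] by simp
  also have "\<dots> \<le> 2 * (a\<^sup>2 * d) + 2 * (b\<^sup>2 * d)"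
    using f g by (intro add_mono mult_left_mono) auto
  also have "\<dots> < 2 * (a\<^sup>2 + b\<^sup>2 + 1) * d"
    using d by (simp add: algebra_simps)
  also have "\<dots> = e" using pos by (simp add: d_def)
  finally show "\<exists>h\<in>Cc_lip. E1 m k (\<lambda>x. h x - (a * u x + b * v x)) < e"
    by (rule bexI[OF _ Cc_lip_lincomb[OF f(1) g(1)]])
qed

text \<open>Modifications on null sets have \<open>E1\<close> distance 0, so closedness
  applies.\<close>

lemma F0_AE_cong:
  assumes u: "u \<in> F0 m k" and u': "u' \<in> borel_measurable m" "AE x in m. u' x = u x"
  shows "u' \<in> F0 m k"
proof (rule F0_closed)
  show *: "u' \<in> Fr m k" using assms by (intro Fr_AE_cong[OF F0_Fr])
  have "E1 m k (\<lambda>x. u x - u' x) = E1 m k (\<lambda>x. u x - u x)"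
    using u u' * by (intro E1_AE_cong Fr_diff) (auto simp: F0_Fr)
  also have "\<dots> = 0" by (simp add: E1_def Eform_def L2ip_def)
  finally show "\<exists>f\<in>F0 m k. E1 m k (\<lambda>x. f x - u' x) < e" if "0 < e" for e
    using u that by (intro bexI[of _ u]) auto
qed

lemma grad_unit_contraction_le: "\<bar>grad (\<lambda>x. min (max (u x) 0) 1) p\<bar> \<le> \<bar>grad u p\<bar>"
  unfolding grad_def abs_mult by (intro mult_right_mono unit_contraction_le) simp

lemma Fr_unit_contraction:
  assumes u: "u \<in> Fr m k"
  shows "(\<lambda>x. min (max (u x) 0) 1) \<in> Fr m k"
proof -
  have [measurable]: "u \<in> borel_measurable m" using u by (auto simp: Fr_iff L2_meas)
  have "(\<lambda>x. min (max (u x) 0) 1) \<in> L2 m"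
    by (rule L2_dominated[of u]) (use u unit_contraction_le[of _ 0] in \<open>auto simp: Fr_iff\<close>)
  moreover have "grad (\<lambda>x. min (max (u x) 0) 1) \<in> L2 P"
    by (rule L2_dominated[of "grad u"]) (use u grad_unit_contraction_le in \<open>auto simp: Fr_iff\<close>)
  ultimately show ?thesis by (simp add: Fr_iff)
qed

text \<open>Truncating the approximants of \<open>u\<close> gives approximants of its truncation.
  The gradient of \<open>T (f n) - T u\<close> is not bounded by that of \<open>f n - u\<close>, so
  convergence is drawn from almost everywhere convergence and \<open>L2_contraction_tendsto\<close>,
  once on \<open>m\<close> and once on \<open>P\<close>.\<close>

lemma F0_unit_contraction:
  assumes u: "u \<in> F0 m k"
  shows "(\<lambda>x. min (max (u x) 0) 1) \<in> F0 m k"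
proof -
  define T where "T s = min (max s 0) (1::real)" for s
  have T_le: "\<bar>T s - T t\<bar> \<le> \<bar>s - t\<bar>" and T0: "T 0 = 0" for s t
    by (simp_all add: T_def unit_contraction_le)
  have T_cont: "isCont T s" for s unfolding T_def by (intro continuous_intros)
  have T_Fr: "(\<lambda>x. T (w x)) \<in> Fr m k" if "w \<in> Fr m k" for w
    unfolding T_def by (rule Fr_unit_contraction[OF that])
  have T_grad: "\<bar>grad (\<lambda>x. T (w x)) p\<bar> \<le> \<bar>grad w p\<bar>" for w p
    unfolding T_def by (rule grad_unit_contraction_le)
  have uF: "u \<in> Fr m k" by (rule F0_Fr[OF u])
  obtain f0 where f0: "\<And>i. f0 i \<in> Cc_lip" "(\<lambda>i. E1 m k (\<lambda>x. f0 i x - u x)) \<longlonglongrightarrow> 0"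
    using u by (auto simp: F0_def)
  have f0F: "f0 i \<in> Fr m k" for i by (rule Cc_lip_Fr[OF f0(1)])
  have E1_eq': "E1 m k (\<lambda>x. w x - u x) =
      L2ip P (\<lambda>p. grad w p - grad u p) (\<lambda>p. grad w p - grad u p) + L2ip m (\<lambda>x. w x - u x) (\<lambda>x. w x - u x)"
    if "w \<in> Fr m k" for w
    using E1_eq[OF Fr_diff[OF that uF]] by (simp add: grad_diff)
  \<comment> \<open>This is needed only to pass to a subsequence that converges almost
    everywhere.\<close>
  have "(\<lambda>i. L2ip m (\<lambda>x. f0 i x - u x) (\<lambda>x. f0 i x - u x)) \<longlonglongrightarrow> 0"
    by (rule tendsto_sandwich[OF _ _ tendsto_const f0(2)])
      (auto intro!: always_eventually simp: L2ip_nonneg E1_eq'[OF f0F])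
  then obtain r where r: "strict_mono (r :: nat \<Rightarrow> nat)" "AE x in m. (\<lambda>n. f0 (r n) x) \<longlonglongrightarrow> u x"
    using L2_tendsto_AE_subseq[of f0 m u] f0F uF by (auto simp: Fr_iff)
  define f where "f n = f0 (r n)" for n
  have f: "f n \<in> Cc_lip" "f n \<in> Fr m k" for n by (simp_all add: f_def f0 f0F)
  have E1_lim: "(\<lambda>i. E1 m k (\<lambda>x. f i x - u x)) \<longlonglongrightarrow> 0"
    using LIMSEQ_subseq_LIMSEQ[OF f0(2) r(1)] by (simp add: f_def o_def)
  have AE_f: "AE x in m. (\<lambda>n. f n x) \<longlonglongrightarrow> u x" using r(2) by (simp add: f_def)
  have AE_T: "AE x in m. (\<lambda>n. T (f n x)) \<longlonglongrightarrow> T (u x)"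
    using AE_f by eventually_elim (rule isCont_tendsto_compose[OF T_cont])
  have AE_grad: "AE p in P. (\<lambda>n. grad (\<lambda>x. T (f n x)) p) \<longlonglongrightarrow> grad (\<lambda>x. T (u x)) p"
    using AE_pair_both[OF AE_T] unfolding grad_def by eventually_elim (intro tendsto_intros; simp)
  have l1: "(\<lambda>n. L2ip m (\<lambda>x. T (f n x) - T (u x)) (\<lambda>x. T (f n x) - T (u x))) \<longlonglongrightarrow> 0"
  proof (rule L2_contraction_tendsto[of f m u])
    show "(\<lambda>i. L2ip m (\<lambda>x. f i x - u x) (\<lambda>x. f i x - u x)) \<longlonglongrightarrow> 0"
      by (rule tendsto_sandwich[OF _ _ tendsto_const E1_lim])
        (auto intro!: always_eventually simp: L2ip_nonneg E1_eq'[OF f(2)])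
  qed (use f(2) uF T_Fr T_le[of _ 0] T0 AE_T in \<open>auto simp: Fr_iff L2_meas\<close>)
  have l2: "(\<lambda>n. L2ip P (\<lambda>p. grad (\<lambda>x. T (f n x)) p - grad (\<lambda>x. T (u x)) p)
      (\<lambda>p. grad (\<lambda>x. T (f n x)) p - grad (\<lambda>x. T (u x)) p)) \<longlonglongrightarrow> 0"
  proof (rule L2_contraction_tendsto[of "\<lambda>n. grad (f n)" P "grad u"])
    show "(\<lambda>i. L2ip P (\<lambda>p. grad (f i) p - grad u p) (\<lambda>p. grad (f i) p - grad u p)) \<longlonglongrightarrow> 0"
      by (rule tendsto_sandwich[OF _ _ tendsto_const E1_lim])
        (auto intro!: always_eventually simp: L2ip_nonneg E1_eq'[OF f(2)])
  qed (use f(2) uF T_Fr T_grad AE_grad in \<open>auto simp: Fr_iff L2_meas\<close>)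
  have "(\<lambda>n. E1 m k (\<lambda>x. T (f n x) - T (u x))) \<longlonglongrightarrow> 0"
    using tendsto_add[OF l2 l1] T_Fr f(2) uF by (simp add: E1_eq Fr_diff grad_diff)
  moreover have "(\<lambda>x. T (f n x)) \<in> Cc_lip" for n
    by (rule Cc_lip_contraction[OF f(1) T_le T0])
  ultimately have "(\<lambda>x. T (u x)) \<in> F0 m k"
    using T_Fr[OF uF] unfolding F0_def by (auto intro!: exI[of _ "\<lambda>n x. T (f n x)"])
  then show ?thesis by (simp add: T_def)
qed

text \<open>The Cauchy property in \<open>L2 m\<close> alone provides the limit \<open>g\<close> of
  an almost everywhere convergent subsequence. The gradients then converge almost everywhere to
  \<open>grad g\<close>, so their limit needs no separate identification.\<close>

lemma Fr_complete:
  fixes f :: "nat \<Rightarrow> 'a \<Rightarrow> real"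
  assumes f: "\<And>i. f i \<in> Fr m k"
    and Cauchy: "\<And>e. 0 < e \<Longrightarrow> \<exists>N. \<forall>i\<ge>N. \<forall>j\<ge>N. E1 m k (\<lambda>x. f i x - f j x) < e"
  obtains g where "g \<in> Fr m k" "\<And>e. 0 < e \<Longrightarrow> \<exists>N. \<forall>i\<ge>N. E1 m k (\<lambda>x. f i x - g x) \<le> e"
proof -
  have E1_eq': "E1 m k (\<lambda>x. f i x - f j x) = L2ip P (\<lambda>p. grad (f i) p - grad (f j) p) (\<lambda>p. grad (f i) p - grad (f j) p)
      + L2ip m (\<lambda>x. f i x - f j x) (\<lambda>x. f i x - f j x)" for i j
    using E1_eq[OF Fr_diff[OF f f], of i j] by (simp add: grad_diff)
  have fL: "f i \<in> L2 m" "grad (f i) \<in> L2 P" for i using f by (auto simp: Fr_iff)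
  have "\<exists>N. \<forall>i\<ge>N. \<forall>j\<ge>N. L2ip m (\<lambda>x. f i x - f j x) (\<lambda>x. f i x - f j x) < e" if e: "0 < e" for e
  proof -
    obtain N where N: "\<forall>i\<ge>N. \<forall>j\<ge>N. E1 m k (\<lambda>x. f i x - f j x) < e" using Cauchy[OF e] by blast
    have "L2ip m (\<lambda>x. f i x - f j x) (\<lambda>x. f i x - f j x) \<le> E1 m k (\<lambda>x. f i x - f j x)" for i j
      unfolding E1_eq' by (simp add: L2ip_nonneg)
    then show ?thesis using N by (meson le_less_trans)
  qed
  from L2_Cauchy_AE_convergent_subseq[OF fL(1) this]
  obtain r g where r: "strict_mono (r :: nat \<Rightarrow> nat)" and g [measurable]: "g \<in> borel_measurable m"
    and lim: "AE x in m. (\<lambda>n. f (r n) x) \<longlonglongrightarrow> g x"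
    by blast
  have lim_grad: "AE p in P. (\<lambda>n. grad (f (r n)) p) \<longlonglongrightarrow> grad g p"
    using AE_pair_both[OF lim] unfolding grad_def by eventually_elim (intro tendsto_intros; simp)
  \<comment> \<open>The first index stays fixed while the second runs along the subsequence; Fatou's
    lemma moves the Cauchy bound to the limit.\<close>
  have key: "\<exists>N. \<forall>i\<ge>N. (\<lambda>x. f i x - g x) \<in> L2 m \<and> (\<lambda>p. grad (f i) p - grad g p) \<in> L2 P \<and>
      L2ip m (\<lambda>x. f i x - g x) (\<lambda>x. f i x - g x) \<le> e \<and>
      L2ip P (\<lambda>p. grad (f i) p - grad g p) (\<lambda>p. grad (f i) p - grad g p) \<le> e" if e: "0 < e" for e
  proof -
    obtain N where N: "\<forall>i\<ge>N. \<forall>j\<ge>N. E1 m k (\<lambda>x. f i x - f j x) < e"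
      using Cauchy[OF e] by blast
    have N': "E1 m k (\<lambda>x. f i x - f (r n) x) < e" if "i \<ge> N" "n \<ge> N" for i n
      using N that seq_suble[OF r, of n] by (meson order_trans)
    have bd: "L2ip m (\<lambda>x. f i x - f (r n) x) (\<lambda>x. f i x - f (r n) x) \<le> e"
      "L2ip P (\<lambda>p. grad (f i) p - grad (f (r n)) p) (\<lambda>p. grad (f i) p - grad (f (r n)) p) \<le> e"
      if "i \<ge> N" "n \<ge> N" for i n
      using N'[OF that] unfolding E1_eq' by (smt (verit) L2ip_nonneg)+
    have AE1: "AE x in m. (\<lambda>n. f i x - f (r n) x) \<longlonglongrightarrow> f i x - g x" for i
      using lim by eventually_elim (intro tendsto_intros)
    have AE2: "AE p in P. (\<lambda>n. grad (f i) p - grad (f (r n)) p) \<longlonglongrightarrow> grad (f i) p - grad g p" for i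
      using lim_grad by eventually_elim (intro tendsto_intros)
    have meas: "(\<lambda>x. f i x - g x) \<in> borel_measurable m" "(\<lambda>p. grad (f i) p - grad g p) \<in> borel_measurable P" for i
      using fL[THEN L2_meas] by auto
    have "(\<lambda>x. f i x - g x) \<in> L2 m" "L2ip m (\<lambda>x. f i x - g x) (\<lambda>x. f i x - g x) \<le> e" if "i \<ge> N" for i
      by (rule L2_Fatou[OF L2_diff[OF fL(1) fL(1)] meas(1) AE1 bd(1)[OF that]]; assumption)+
    moreover have "(\<lambda>p. grad (f i) p - grad g p) \<in> L2 P"
      "L2ip P (\<lambda>p. grad (f i) p - grad g p) (\<lambda>p. grad (f i) p - grad g p) \<le> e" if "i \<ge> N" for i
      by (rule L2_Fatou[OF L2_diff[OF fL(2) fL(2)] meas(2) AE2 bd(2)[OF that]]; assumption)+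
    ultimately show ?thesis by blast
  qed
  have diff: "\<exists>N. \<forall>i\<ge>N. (\<lambda>x. f i x - g x) \<in> Fr m k \<and> E1 m k (\<lambda>x. f i x - g x) \<le> e" if e: "0 < e" for e
  proof -
    obtain N where N: "\<forall>i\<ge>N. (\<lambda>x. f i x - g x) \<in> L2 m \<and> (\<lambda>p. grad (f i) p - grad g p) \<in> L2 P \<and>
      L2ip m (\<lambda>x. f i x - g x) (\<lambda>x. f i x - g x) \<le> e / 2 \<and>
      L2ip P (\<lambda>p. grad (f i) p - grad g p) (\<lambda>p. grad (f i) p - grad g p) \<le> e / 2"
      using key[of "e / 2"] e by auto
    have "(\<lambda>x. f i x - g x) \<in> Fr m k \<and> E1 m k (\<lambda>x. f i x - g x) \<le> e" if "i \<ge> N" for i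
    proof -
      have 1: "(\<lambda>x. f i x - g x) \<in> Fr m k"
        using N that by (simp add: Fr_iff grad_diff)
      have "E1 m k (\<lambda>x. f i x - g x) \<le> e / 2 + e / 2"
        unfolding E1_eq[OF 1] grad_diff using N that by (intro add_mono) auto
      then show ?thesis using 1 by simp
    qed
    then show ?thesis by blast
  qed
  \<comment> \<open>So far only differences are known to lie in \<open>Fr\<close>; \<open>g\<close>
    is recovered as \<open>f N\<close> minus one of them.\<close>
  obtain N where "(\<lambda>x. f N x - g x) \<in> Fr m k" using diff[of 1] by auto
  from Fr_diff[OF f[of N] this] have "g \<in> Fr m k" by simp
  then show ?thesis using diff by (intro that) blast+
qed

lemma E1_le_form_norm: "u \<in> Fr m k \<Longrightarrow> E1 m k u \<le> 4 * (form_norm m eta alpha u)\<^sup>2"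
  using E1_le_eta[of u] by (simp only: form_norm_square)

text \<open>The form norm squared is equivalent to \<open>E1\<close>, so completeness of
  \<open>Fr\<close> transfers, and \<open>F0_closed\<close> keeps the limit in
  \<open>F0\<close>.\<close>

lemma form_norm_complete:
  assumes f: "\<And>i. f i \<in> F0 m k"
    and Cauchy: "\<And>e. 0 < e \<Longrightarrow> \<exists>N. \<forall>i\<ge>N. \<forall>j\<ge>N. form_norm m eta alpha (\<lambda>x. f i x - f j x) < e"
  shows "\<exists>g\<in>F0 m k. (\<lambda>i. form_norm m eta alpha (\<lambda>x. f i x - g x)) \<longlonglongrightarrow> 0"
proof -
  note fF = F0_Fr[OF f]
  have "\<exists>N. \<forall>i\<ge>N. \<forall>j\<ge>N. E1 m k (\<lambda>x. f i x - f j x) < e" if e: "0 < e" for e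
  proof -
    \<comment> \<open>The square of this threshold absorbs the factor 4 of
      \<open>E1_le_form_norm\<close>.\<close>
    obtain N where N: "\<forall>i\<ge>N. \<forall>j\<ge>N. form_norm m eta alpha (\<lambda>x. f i x - f j x) < sqrt (e / 4)"
      using Cauchy[of "sqrt (e / 4)"] e by auto
    have "E1 m k (\<lambda>x. f i x - f j x) < e" if "i \<ge> N" "j \<ge> N" for i j
    proof -
      have d: "(\<lambda>x. f i x - f j x) \<in> Fr m k" by (intro Fr_diff fF)
      have "(form_norm m eta alpha (\<lambda>x. f i x - f j x))\<^sup>2 < (sqrt (e / 4))\<^sup>2"
        using N that by (intro power_strict_mono form_norm_nonneg[OF d]) auto
      then show ?thesis using E1_le_form_norm[OF d] e by simp
    qed
    then show ?thesis by blast
  qed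
  then obtain g where g: "g \<in> Fr m k" "\<And>e. 0 < e \<Longrightarrow> \<exists>N. \<forall>i\<ge>N. E1 m k (\<lambda>x. f i x - g x) \<le> e"
    using Fr_complete[of f] fF by metis
  have E1_lim: "(\<lambda>i. E1 m k (\<lambda>x. f i x - g x)) \<longlonglongrightarrow> 0"
  proof (rule LIMSEQ_I)
    fix e :: real assume e: "0 < e"
    then obtain N where "\<forall>i\<ge>N. E1 m k (\<lambda>x. f i x - g x) \<le> e / 2" using g(2)[of "e / 2"] by auto
    then have "norm (E1 m k (\<lambda>x. f i x - g x) - 0) < e" if "i \<ge> N" for i
      using that e E1_nonneg[OF Fr_diff[OF fF g(1)], of i] by fastforce
    then show "\<exists>N. \<forall>i\<ge>N. norm (E1 m k (\<lambda>x. f i x - g x) - 0) < e" by blast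
  qed
  have "g \<in> F0 m k"
  proof (rule F0_closed[OF g(1)])
    fix e :: real assume "0 < e"
    from eventually_happens[OF order_tendstoD(2)[OF E1_lim this]]
    show "\<exists>h\<in>F0 m k. E1 m k (\<lambda>x. h x - g x) < e" using f by auto
  qed
  moreover have "(\<lambda>i. form_norm m eta alpha (\<lambda>x. f i x - g x)) \<longlonglongrightarrow> 0"
  proof (rule tendsto_sandwich[OF _ _ tendsto_const])
    show "(\<lambda>i. sqrt ((2 * C + 1) * E1 m k (\<lambda>x. f i x - g x))) \<longlonglongrightarrow> 0"
      using tendsto_real_sqrt[OF tendsto_mult[OF tendsto_const[of "2 * C + 1"] E1_lim]] by simp
  qed (intro always_eventually allI form_norm_nonneg form_norm_le Fr_diff fF g(1))+
  ultimately show ?thesis by blast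
qed

section \<open>The semi-Dirichlet properties of \<open>eta\<close> collected\<close>

lemma bilinear_form_eta: "bilinear_form_L2 m eta (F0 m k)"
  unfolding bilinear_form_L2_def
proof (intro conjI ballI allI impI)
  show "F0 m k \<subseteq> L2 m" using F0_Fr by (auto simp: Fr_iff)
  have "(\<lambda>x. 0) \<in> Cc_lip" by (simp add: Cc_lip_def) (metis lipschitz_on_constant)
  then show "(\<lambda>x. 0) \<in> F0 m k" by (rule Cc_lip_F0)
qed (auto intro: F0_lincomb F0_AE_cong eta_AE_cong eta_lincomb_left eta_lincomb_right F0_Fr)

lemma lbsdf_eta: "lbsdf_with m eta (F0 m k) alpha (2 + 2 * sqrt C)"
  unfolding lbsdf_with_def
proof (intro conjI ballI allI impI)
  show "0 < alpha" "0 < 2 + 2 * sqrt C"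
    using C_nonneg by (auto intro: add_pos_nonneg)
  show "- alpha * L2ip m u u \<le> eta u u" if "u \<in> F0 m k" for u
    by (rule eta_ge[OF F0_Fr[OF that]])
qed (auto intro: bilinear_form_eta eta_sector form_norm_complete F0_unit_contraction
    eta_unit_contraction_nonneg Fr_unit_contraction F0_Fr)

lemma Cc_lip_dense_F0:
  assumes u: "u \<in> F0 m k" and e: "0 < e"
  shows "\<exists>g\<in>Cc_lip. form_norm m eta alpha (\<lambda>x. u x - g x) < e"
proof -
  obtain f where f: "\<And>i. f i \<in> Cc_lip" "(\<lambda>i. E1 m k (\<lambda>x. f i x - u x)) \<longlonglongrightarrow> 0"
    using u by (auto simp: F0_def)
  have "(\<lambda>i. sqrt ((2 * C + 1) * E1 m k (\<lambda>x. f i x - u x))) \<longlonglongrightarrow> 0"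
    using tendsto_real_sqrt[OF tendsto_mult[OF tendsto_const[of "2 * C + 1"] f(2)]] by simp
  from eventually_happens[OF order_tendstoD(2)[OF this e]]
  obtain i where "sqrt ((2 * C + 1) * E1 m k (\<lambda>x. f i x - u x)) < e" by auto
  then have "form_norm m eta alpha (\<lambda>x. u x - f i x) < e"
    using form_norm_le[OF Fr_diff[OF F0_Fr[OF u] Cc_lip_Fr[OF f(1)]], of i]
    by (simp add: E1_minus_commute[of u])
  then show ?thesis using f(1) by blast
qed

end

subsection \<open>Density, separability and the diagonal\<close>

text \<open>A Lebesgue number for the cover of the support by preimages of balls of radius
  \<open>e / 2\<close>. It suffices that one of the two points lies in the support, since otherwise
  both values are 0.\<close>

lemma Cc_uniformly_continuous:
  fixes f :: "'a::metric_space \<Rightarrow> real"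
  assumes f: "f \<in> Cc" and e: "0 < e"
  obtains d where "0 < d" "\<And>x y. dist x y < d \<Longrightarrow> \<bar>f x - f y\<bar> < e"
proof -
  let ?K = "closure {x. f x \<noteq> 0}"
  have K: "compact ?K" and cont: "continuous_on UNIV f" using f by (auto simp: Cc_def)
  let ?G = "range (\<lambda>t. f -` ball t (e / 2))"
  have "x \<in> f -` ball (f x) (e / 2)" for x using e by simp
  then have cover: "?K \<subseteq> \<Union> ?G" by blast
  have "open G" if "G \<in> ?G" for G
    using that cont by (auto intro: open_vimage)
  then obtain d where d: "0 < d" "\<And>x. x \<in> ?K \<Longrightarrow> \<exists>G\<in>?G. ball x d \<subseteq> G"
    using Heine_Borel_lemma[OF K cover] by blast
  have near: "\<bar>f x - f y\<bar> < e" if xy: "x \<in> ?K" "dist x y < d" for x y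
  proof -
    obtain t where t: "ball x d \<subseteq> f -` ball t (e / 2)" using d(2)[OF xy(1)] by auto
    have "x \<in> ball x d" "y \<in> ball x d" using d(1) xy(2) by auto
    then have "x \<in> f -` ball t (e / 2)" "y \<in> f -` ball t (e / 2)" using t by blast+
    then have "\<bar>t - f x\<bar> < e / 2" "\<bar>t - f y\<bar> < e / 2" by (auto simp: dist_real_def)
    then show ?thesis by linarith
  qed
  have supp: "f x = 0" if "x \<notin> ?K" for x
    using that closure_subset[of "{x. f x \<noteq> 0}"] by auto
  have "\<bar>f x - f y\<bar> < e" if "dist x y < d" for x y
    using near[of x y] near[of y x] supp[of x] supp[of y] that e
    by (cases "x \<in> ?K"; cases "y \<in> ?K") (auto simp: dist_commute abs_minus_commute)
  with d(1) show ?thesis by (rule that)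
qed

text \<open>The infimal convolution \<open>h\<close> of \<open>f\<close> with \<open>n d\<close> is Lipschitz and uniformly close to \<open>f\<close>; moving
  its values towards \<open>0\<close> by the error makes its support shrink into that of \<open>f\<close>.\<close>
lemma Cc_lip_uniformly_dense:
  fixes f :: "'a::metric_space \<Rightarrow> real"
  assumes f: "f \<in> Cc" and e: "0 < e"
  shows "\<exists>g\<in>Cc_lip. \<forall>x. \<bar>f x - g x\<bar> < e"
proof -
  obtain B where B: "0 \<le> B" "\<And>x. \<bar>f x\<bar> \<le> B" using Cc_bounded[OF f] by metis
  \<comment> \<open>The convolution and the shift towards 0 each cost at most \<open>c\<close>, and
    \<open>2 * c < e\<close>.\<close>
  define c where "c = e / 3"
  have c: "0 < c" using e by (simp add: c_def)
  obtain d where d: "0 < d" "\<And>x y. dist x y < d \<Longrightarrow> \<bar>f x - f y\<bar> < c"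
    using Cc_uniformly_continuous[OF f c] by metis
  \<comment> \<open>At distance at least \<open>d\<close> the penalty reaches \<open>2 * B\<close>,
    the largest possible oscillation of \<open>f\<close>.\<close>
  define n where "n = 2 * B / d"
  have n: "0 \<le> n" using B d by (simp add: n_def)
  define h where "h x = (INF y. f y + n * dist x y)" for x
  have bdd: "bdd_below (range (\<lambda>y. f y + n * dist x y))" for x
  proof (rule bdd_belowI2)
    fix y
    have "- B \<le> f y" using B(2)[of y] by linarith
    moreover have "0 \<le> n * dist x y" using n by simp
    ultimately show "- B \<le> f y + n * dist x y" by linarith
  qed
  have h_le: "h x \<le> f y + n * dist x y" for x y
    unfolding h_def by (rule cINF_lower[OF bdd]) simp
  have le_h: "f x - c \<le> h x" for x
    unfolding h_def
  proof (rule cINF_greatest)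
    fix y
    show "f x - c \<le> f y + n * dist x y"
    proof (cases "dist x y < d")
      case True
      then have "\<bar>f x - f y\<bar> < c" by (rule d(2))
      moreover have "0 \<le> n * dist x y" using n by simp
      ultimately show ?thesis by linarith
    next
      case False
      then have "n * d \<le> n * dist x y" using n by (intro mult_left_mono) auto
      moreover have "n * d = 2 * B" using d(1) by (simp add: n_def)
      ultimately show ?thesis using B(2)[of x] B(2)[of y] c by (simp add: abs_le_iff)
    qed
  qed simp
  have near: "\<bar>f x - h x\<bar> \<le> c" for x
    using h_le[of x x] le_h[of x] c by simp
  have h_lip: "h x \<le> h y + n * dist x y" for x y
  proof -
    have "h x - n * dist x y \<le> f z + n * dist y z" for z
    proof -
      have "n * dist x z \<le> n * (dist x y + dist y z)"
        using n by (intro mult_left_mono dist_triangle)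
      then show ?thesis using h_le[of x z] by (simp add: algebra_simps)
    qed
    then have "h x - n * dist x y \<le> h y"
      unfolding h_def[of y] by (intro cINF_greatest) auto
    then show ?thesis by simp
  qed
  define g where "g x = h x - max (- c) (min (h x) c)" for x
  have "g \<in> Cc_lip"
  proof (rule Cc_lipI)
    show "n-lipschitz_on UNIV g"
    proof (rule lipschitz_onI)
      fix x y
      have "\<bar>g x - g y\<bar> \<le> \<bar>h x - h y\<bar>"
        using c by (auto simp: g_def min_def max_def)
      also have "\<dots> \<le> n * dist x y"
        using h_lip[of x y] h_lip[of y x] by (simp add: dist_commute abs_le_iff)
      finally show "dist (g x) (g y) \<le> n * dist x y" by (simp add: dist_real_def)
    qed (rule n)
    show "compact (closure {x. f x \<noteq> 0})" using f by (simp add: Cc_def)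
    show "x \<in> closure {x. f x \<noteq> 0}" if "g x \<noteq> 0" for x
    proof (rule subsetD[OF closure_subset])
      have "g x = 0" if "\<bar>h x\<bar> \<le> c" using that by (simp add: g_def abs_le_iff)
      then show "x \<in> {x. f x \<noteq> 0}" using that near[of x] by force
    qed
  qed
  moreover have "\<bar>f x - g x\<bar> < e" for x
  proof -
    have "\<bar>h x - g x\<bar> \<le> c" using c by (auto simp: g_def min_def max_def)
    then have "\<bar>f x - g x\<bar> \<le> c + c" using near[of x] by linarith
    then show ?thesis using e by (simp add: c_def)
  qed
  ultimately show ?thesis by blast
qed

text \<open>The balls with centre in \<open>D\<close>, radius \<open>1 / (n + 1)\<close> and a
  compact superset are countably many and have finite measure. Local compactness and density make
  them cover the space.\<close>

lemma sigma_finite_locally_compact_separable: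
  fixes m :: "'a::metric_space measure"
  assumes lc: "locally compact (UNIV :: 'a set)"
    and D: "countable (D :: 'a set)" "closure D = UNIV"
    and sets_m: "sets m = sets borel"
    and fin: "\<And>K. compact K \<Longrightarrow> emeasure m K < \<infinity>"
  shows "sigma_finite_measure m"
proof
  let ?A = "{A \<in> (\<lambda>(d, n). ball d (1 / real (Suc n))) ` (D \<times> UNIV). \<exists>K. compact K \<and> A \<subseteq> K}"
  have cover: "x \<in> \<Union> ?A" for x
  proof -
    obtain U K where U: "openin (top_of_set UNIV) U" "compact K" "x \<in> U" "U \<subseteq> K"
      using locallyE[OF lc, of UNIV x] by auto
    then have "open U" by simp
    then obtain r where r: "0 < r" "ball x r \<subseteq> U" using U(3) by (meson open_contains_ball)
    \<comment> \<open>Half of \<open>r\<close> is needed because the ball is centred at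
      \<open>d\<close>, not at \<open>x\<close>.\<close>
    obtain n where n: "1 / real (Suc n) < r / 2"
      using reals_Archimedean[of "r / 2"] r(1) by (auto simp: inverse_eq_divide)
    have "x \<in> closure D" using D(2) by simp
    then obtain d where d: "d \<in> D" "dist d x < 1 / real (Suc n)"
      unfolding closure_approachable by (metis of_nat_0_less_iff zero_less_Suc zero_less_divide_1_iff)
    have "ball d (1 / real (Suc n)) \<subseteq> ball x r"
    proof
      fix y assume "y \<in> ball d (1 / real (Suc n))"
      then have "dist d y < r / 2" using n by simp
      moreover have "dist d x < r / 2" using d(2) n by simp
      ultimately have "dist x y < r" using dist_triangle[of x y d] by (simp add: dist_commute)
      then show "y \<in> ball x r" by simp
    qed
    then have "ball d (1 / real (Suc n)) \<subseteq> K" using r(2) U(4) by blast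
    then have "ball d (1 / real (Suc n)) \<in> ?A" using d(1) U(2) by auto
    then show ?thesis by (rule UnionI) (use d(2) in simp)
  qed
  have "countable ?A"
    using D(1) by (intro countable_Collect countable_image countable_SIGMA) auto
  moreover have "?A \<subseteq> sets m" by (auto simp: sets_m)
  moreover have "emeasure m A \<noteq> \<infinity>" if A: "A \<in> ?A" for A
  proof -
    obtain K where K: "compact K" "A \<subseteq> K" using A by blast
    have "emeasure m A \<le> emeasure m K"
      using K by (intro emeasure_mono) (auto simp: sets_m borel_compact)
    also have "\<dots> < \<infinity>" by (rule fin[OF K(1)])
    finally show ?thesis by simp
  qed
  moreover have "\<Union> ?A = space m"
    using cover sets_eq_imp_space_eq[OF sets_m] by (simp add: set_eq_iff)
  ultimately show "\<exists>A. countable A \<and> A \<subseteq> sets m \<and> \<Union> A = space m \<and> (\<forall>a\<in>A. emeasure m a \<noteq> \<infinity>)"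
    by (intro exI[of _ ?A] conjI ballI)
qed

text \<open>Without second countability as a type class, the distance is recovered as
  \<open>d(x, y) = sup\<^sub>z\<^sub>\<in>\<^sub>D \<bar>d(x, z) - d(y, z)\<bar>\<close> over a countable dense set.\<close>
lemma borel_measurable_dist_separable:
  assumes D: "countable (D :: 'a::metric_space set)" "closure D = UNIV"
  shows "(\<lambda>p::'a \<times> 'a. dist (fst p) (snd p)) \<in> borel_measurable (borel \<Otimes>\<^sub>M borel)"
proof -
  have [measurable]: "(\<lambda>x. dist x z) \<in> borel_measurable borel" for z :: 'a
    by (intro borel_measurable_continuous_onI continuous_intros)
  have "{p :: 'a \<times> 'a. a < dist (fst p) (snd p)} \<in> sets (borel \<Otimes>\<^sub>M borel)" for a
  proof -
    have "{p :: 'a \<times> 'a. a < dist (fst p) (snd p)} =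
        (\<Union>z\<in>D. {p. a < \<bar>dist (fst p) z - dist (snd p) z\<bar>})" (is "?L = ?R")
    proof (rule antisym; rule subsetI)
      fix p assume "p \<in> ?L"
      then have p: "a < dist (fst p) (snd p)" by simp
      \<comment> \<open>Replacing the second point by \<open>z\<close> costs
        \<open>dist z (snd p)\<close> twice, hence half of the gap.\<close>
      define e where "e = (dist (fst p) (snd p) - a) / 2"
      have e: "0 < e" using p by (simp add: e_def)
      have "snd p \<in> closure D" using D(2) by simp
      then obtain z where z: "z \<in> D" "dist z (snd p) < e"
        unfolding closure_approachable using e by blast
      have "dist (fst p) (snd p) \<le> dist (fst p) z + dist z (snd p)" by (rule dist_triangle)
      then have "a < dist (fst p) z - dist (snd p) z"
        using z(2) by (simp add: e_def dist_commute field_simps)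
      then show "p \<in> ?R" using z(1) by (auto intro!: bexI[of _ z])
    next
      fix p assume "p \<in> ?R"
      then obtain z where z: "a < \<bar>dist (fst p) z - dist (snd p) z\<bar>" by auto
      have "\<bar>dist (fst p) z - dist (snd p) z\<bar> \<le> dist (fst p) (snd p)"
        using dist_triangle[of "fst p" z "snd p"] dist_triangle[of "snd p" z "fst p"]
        by (simp add: dist_commute abs_le_iff)
      then show "p \<in> ?L" using z by simp
    qed
    also have "\<dots> \<in> sets (borel \<Otimes>\<^sub>M borel)"
    proof (rule sets.countable_UN''[OF D(1)])
      fix z assume "z \<in> D"
      have "{p \<in> space (borel \<Otimes>\<^sub>M borel). a < \<bar>dist (fst p) z - dist (snd p) z\<bar>} \<in> sets (borel \<Otimes>\<^sub>M borel)"
        by measurable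
      then show "{p. a < \<bar>dist (fst p) z - dist (snd p) z\<bar>} \<in> sets (borel \<Otimes>\<^sub>M borel)"
        by (simp add: space_pair_measure)
    qed
    finally show ?thesis .
  qed
  then show ?thesis
    by (simp add: borel_measurable_iff_greater space_pair_measure)
qed

text \<open>The given kernel is unconstrained on the diagonal. Setting it to 0 there makes it an
  instance of \<open>jump_form\<close> and changes none of the forms, whose integrands all exclude
  the diagonal.\<close>

definition offdiag :: "('a \<Rightarrow> 'a \<Rightarrow> real) \<Rightarrow> 'a \<Rightarrow> 'a \<Rightarrow> real" where
  "offdiag k x y = (if x = y then 0 else k x y)"

lemma ks_offdiag: "ks (offdiag k) x y = (if x = y then 0 else ks k x y)"
  and ka_offdiag: "ka (offdiag k) x y = (if x = y then 0 else ka k x y)"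
  by (auto simp: ks_def ka_def offdiag_def)

lemma Eform_offdiag: "Eform m (offdiag k) = Eform m k"
  unfolding Eform_def ks_offdiag
  by (intro ext Bochner_Integration.integral_cong refl) (auto split: split_indicator)

lemma Eform_nn_offdiag: "Eform_nn m (offdiag k) = Eform_nn m k"
  unfolding Eform_nn_def ks_offdiag
  by (intro ext nn_integral_cong) (auto split: split_indicator)

lemma F0_offdiag: "F0 m (offdiag k) = F0 m k"
  unfolding F0_def Fr_def E1_def Eform_offdiag Eform_nn_offdiag ..

text \<open>The truncated region avoids the diagonal even for \<open>n = 0\<close>, where it is
  \<open>dist x y > 0\<close>.\<close>

lemma eta_n_offdiag: "eta_n m (offdiag k) n = eta_n m k n"
proof -
  have "Ln m (offdiag k) n = Ln m k n"
    unfolding Ln_def offdiag_def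
    by (intro ext Bochner_Integration.integral_cong refl) (auto split: split_indicator)
  then show ?thesis by (intro ext) (simp add: eta_n_def)
qed

theorem theorem1p1:
  fixes m :: "'a::metric_space measure" and k :: "'a \<Rightarrow> 'a \<Rightarrow> real"
  assumes loc_compact: "locally compact (UNIV :: 'a set)"
    and separable: "\<exists>D :: 'a set. countable D \<and> closure D = UNIV"
    and sets_m: "sets m = sets borel"
    and radon: "\<forall>K. compact K \<longrightarrow> emeasure m K < \<infinity>"
    and full_support: "\<forall>U. open U \<and> U \<noteq> {} \<longrightarrow> emeasure m U > 0"
    and k_nonneg: "\<forall>x y. x \<noteq> y \<longrightarrow> k x y \<ge> 0"
    and k_meas: "(\<lambda>p. indicator {p. fst p \<noteq> snd p} p * k (fst p) (snd p))
                   \<in> borel_measurable (borel \<Otimes>\<^sub>M borel)"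
    and L1loc: "\<forall>K. compact K \<longrightarrow>
       (\<integral>\<^sup>+x\<in>K. (\<integral>\<^sup>+y. indicator {y. y \<noteq> x} y * ennreal (min 1 ((dist x y)\<^sup>2) * ks k x y) \<partial>m) \<partial>m) < \<infinity>"
    and sup_bound: "\<exists>C::real. \<forall>x.
       (\<integral>\<^sup>+y. indicator {y. y \<noteq> x \<and> ks k x y \<noteq> 0} y * ennreal ((ka k x y)\<^sup>2 / ks k x y) \<partial>m) \<le> ennreal C"
  shows "(\<forall>u\<in>Cc_lip. \<forall>v\<in>Cc_lip.
            integrable (m \<Otimes>\<^sub>M m)
              (\<lambda>p. indicator {p. fst p \<noteq> snd p} p * ((u (fst p) - u (snd p)) * v (snd p) * ka k (fst p) (snd p))) \<and>
            (\<lambda>n. eta_n m k n u v) \<longlonglongrightarrow>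
              (Eform m k u v / 2 +
               (\<integral>x. (\<integral>y. indicator {y. y \<noteq> x} y * ((u x - u y) * v y * ka k x y) \<partial>m) \<partial>m)))
       \<and> (\<exists>eta. (\<forall>u\<in>Cc_lip. \<forall>v\<in>Cc_lip. eta u v = lim (\<lambda>n. eta_n m k n u v)) \<and>
                regular_lbsdf m eta (F0 m k))"
proof -
  obtain D :: "'a set" where D: "countable D" "closure D = UNIV" using separable by blast
  obtain C where C: "\<And>x. (\<integral>\<^sup>+y. indicator {y. y \<noteq> x \<and> ks k x y \<noteq> 0} y *
      ennreal ((ka k x y)\<^sup>2 / ks k x y) \<partial>m) \<le> ennreal C"
    using sup_bound by blast
  have pair_cong: "borel_measurable (m \<Otimes>\<^sub>M m) = borel_measurable (borel \<Otimes>\<^sub>M (borel :: 'a measure))"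
    by (intro measurable_cong_sets sets_pair_measure_cong sets_m refl)
  have sf: "sigma_finite_measure m"
    using loc_compact D sets_m radon by (intro sigma_finite_locally_compact_separable) auto
  \<comment> \<open>The given \<open>C\<close> may be negative, where \<open>ennreal\<close> returns
    0; the locale asks for a nonnegative real constant.\<close>
  interpret J: jump_form m "offdiag k" "max C 0"
  proof (intro jump_form.intro sf jump_form_axioms.intro)
    show "(\<lambda>p. offdiag k (fst p) (snd p)) \<in> borel_measurable (m \<Otimes>\<^sub>M m)"
    proof -
      have "(\<lambda>p. offdiag k (fst p) (snd p)) = (\<lambda>p. indicator {p. fst p \<noteq> snd p} p * k (fst p) (snd p))"
        by (auto simp: offdiag_def fun_eq_iff)
      then show ?thesis using k_meas by (simp add: pair_cong)
    qed
    show "(\<lambda>p. dist (fst p) (snd p)) \<in> borel_measurable (m \<Otimes>\<^sub>M m)"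
      unfolding pair_cong by (rule borel_measurable_dist_separable[OF D])
    show "(\<integral>\<^sup>+x\<in>K. (\<integral>\<^sup>+y. ennreal (min 1 ((dist x y)\<^sup>2) * ks (offdiag k) x y) \<partial>m) \<partial>m) < \<infinity>"
      if "compact K" for K
    proof -
      have "(\<integral>\<^sup>+y. ennreal (min 1 ((dist x y)\<^sup>2) * ks (offdiag k) x y) \<partial>m) =
          (\<integral>\<^sup>+y. indicator {y. y \<noteq> x} y * ennreal (min 1 ((dist x y)\<^sup>2) * ks k x y) \<partial>m)" for x
        unfolding ks_offdiag by (intro nn_integral_cong) (auto split: split_indicator)
      then show ?thesis using L1loc that by simp
    qed
    show "(\<integral>\<^sup>+y. ennreal ((ka (offdiag k) x y)\<^sup>2 / ks (offdiag k) x y) \<partial>m) \<le> ennreal (max C 0)" for x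
    proof -
      \<comment> \<open>Both sides agree where \<open>ks k x y = 0\<close>, since the quotient is
        then 0 by convention.\<close>
      have "(\<integral>\<^sup>+y. ennreal ((ka (offdiag k) x y)\<^sup>2 / ks (offdiag k) x y) \<partial>m) =
          (\<integral>\<^sup>+y. indicator {y. y \<noteq> x \<and> ks k x y \<noteq> 0} y * ennreal ((ka k x y)\<^sup>2 / ks k x y) \<partial>m)"
        unfolding ks_offdiag ka_offdiag by (intro nn_integral_cong) (auto split: split_indicator)
      also have "\<dots> \<le> ennreal C" by (rule C)
      also have "\<dots> \<le> ennreal (max C 0)" by (intro ennreal_leI) simp
      finally show ?thesis .
    qed
  qed (use sets_m radon k_nonneg in \<open>auto simp: offdiag_def\<close>)
  \<comment> \<open>Under an off-diagonal indicator the two kernels agree; this and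
    \<open>ka_ind2\<close> return the drift integrals to \<open>k\<close>.\<close>
  have ka_ind: "indicator {y. y \<noteq> x} y * (a * ka (offdiag k) x y) = indicator {y. y \<noteq> x} y * (a * ka k x y)"
    for x y :: 'a and a :: real
    by (auto simp: ka_offdiag split: split_indicator)
  have ka_ind2: "indicator {p. fst p \<noteq> snd p} p * (a * ka (offdiag k) (fst p) (snd p)) =
      indicator {p. fst p \<noteq> snd p} p * (a * ka k (fst p) (snd p))"
    for p :: "'a \<times> 'a" and a :: real
    by (auto simp: ka_offdiag split: split_indicator)
  have lim: "(\<lambda>n. eta_n m k n u v) \<longlonglongrightarrow> J.eta u v" if "u \<in> Cc_lip" "v \<in> Cc_lip" for u v
    using J.eta_n_tendsto[OF that] by (simp add: eta_n_offdiag)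
  have "regular_lbsdf m J.eta (F0 m (offdiag k))"
    unfolding regular_lbsdf_def
  proof (intro exI conjI ballI allI impI)
    show "lbsdf_with m J.eta (F0 m (offdiag k)) J.alpha (2 + 2 * sqrt (max C 0))"
      by (rule J.lbsdf_eta)
    show "\<exists>g\<in>F0 m (offdiag k) \<inter> Cc. form_norm m J.eta J.alpha (\<lambda>x. u x - g x) < e"
      if "u \<in> F0 m (offdiag k)" "0 < e" for u e
      using J.Cc_lip_dense_F0[OF that] J.Cc_lip_F0 Cc_lip_subset_Cc by blast
    show "\<exists>g\<in>F0 m (offdiag k) \<inter> Cc. \<forall>x. \<bar>f x - g x\<bar> < e" if "f \<in> Cc" "0 < e" for f e
      using Cc_lip_uniformly_dense[OF that] J.Cc_lip_F0 Cc_lip_subset_Cc by blast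
  qed
  then have reg: "regular_lbsdf m J.eta (F0 m k)" by (simp only: F0_offdiag)
  show ?thesis
  proof (intro conjI ballI exI[of _ J.eta])
    fix u v :: "'a \<Rightarrow> real" assume uv: "u \<in> Cc_lip" "v \<in> Cc_lip"
    note F = J.Cc_lip_Fr[OF uv(1)] J.Cc_lip_Fr[OF uv(2)]
    show "integrable (m \<Otimes>\<^sub>M m) (\<lambda>p. indicator {p. fst p \<noteq> snd p} p *
        ((u (fst p) - u (snd p)) * v (snd p) * ka k (fst p) (snd p)))"
      using J.grad_drift_integrable[OF F] by (simp only: ka_ind2)
    show "(\<lambda>n. eta_n m k n u v) \<longlonglongrightarrow> Eform m k u v / 2 +
        (\<integral>x. (\<integral>y. indicator {y. y \<noteq> x} y * ((u x - u y) * v y * ka k x y) \<partial>m) \<partial>m)"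
      using lim[OF uv] unfolding J.eta_eq[OF F] Eform_offdiag ka_ind .
    show "J.eta u v = lim (\<lambda>n. eta_n m k n u v)"
      using limI[OF lim[OF uv]] by simp
  qed (rule reg)
qed

end
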